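(* Let $(v_n)_{n\ge 0}$ be the integer sequence defined below. Then: 1. $v_n$ is odd for every $n\ge 1$. 2. For every integer $k\ge 1$ and every $l\ge 0$: $v_{lk+1}\equiv v_{lk+2} \pmod k$. 3. For every even $k\ge 2$ and every $l\ge 0$: $v_{lk+k/2+1}\equiv v_{lk+k/2+2}\pmod k$. 4. For every odd $k\ge 3$ and every $l\ge 0$: $v_{lk+(k+3)/2}\equiv 0\pmod k$. 5. For every prime $k$: $v_1\equiv v_2\equiv v_{k+1}\equiv v_{k+2}\equiv 1\pmod k$, and $v_{lk+1}\equiv v_{lk+2}\equiv -1 \pmod k$ for every $l$ with $2\le l\le k+1$. 6. For every prime $k>2$: $v_i\equiv 0\pmod k$ for all $i$ with $(k+3)/2\le i\le k$. 7. For every prime $k>2$: $v_{lk+i}\equiv 0\pmod k$ for all $l$ with $(k-1)/2\le l\le k$ and all $i$ with $(k+3)/2\le i\le k$. 8. For every $q\ge 1$, with $k=2^q$: $v_{lk+i}\equiv v_i\pmod{2^q}$ for all $l\ge 0$ and $1\le i\le 2^q$; moreover, for every odd integer $a$ there are exactly two indices $i\in\{1,\dots,2^q\}$ with $v_i\equiv a\pmod{2^q}$. 9. For every $q\ge 2$: $v_1\equiv v_2\equiv 1$, $v_{2^{q-1}}\equiv 2^{q-1}-1$, $v_{2^{q-1}+1}\equiv v_{2^{q-1}+2}\equiv 2^{q-1}+1$, and $v_{2^q}\equiv 2^q-1$, all modulo $2^q$. 10. For every $q\ge 2$ and every $a$ with $1\le a\le 2^{q-1}$: $v_{a+2^{q-1}}\equiv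 v_a+2^{q-1}\pmod{2^q}$.
   Context: For an integer $n\ge 1$ let $v_n=\Big[(1-x)\prod_{j=0}^{2n-3}(2n-3-j+jx)\Big]_{x^{n-1}}$, where $[f(x)]_{x^m}$ denotes the coefficient of $x^m$ in the polynomial $f$ (an empty product equals $1$, so $v_1=1$); additionally set $v_0=-1$. For $n\ge 2$, $v_n$ is the number of lines on a generic hypersurface of degree $2n-3$ in $\mathbb{P}^n$ ($v_2=1,v_3=27,v_4=2875,\dots$). The paper phrases these results via tables: for a modulus $k$, the entry in row $i$ ($1\le i\le k$) and column $l$ ($l\ge 0$) of the table is $v_{lk+i}\bmod k$; the statements above are written directly in terms of $v_n$. *)

theory Defs
  imports "HOL-Number_Theory.Number_Theory" "HOL-Computational_Algebra.Polynomial"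
begin

(* The index j runs over 0, ..., 2n - 3, that is j < 2n - 2; this range is empty for n = 1. *)
definition v :: "nat \<Rightarrow> int" where
  "v n = (if n = 0 then -1
          else coeff ([:1, -1:] * (\<Prod>j<2 * n - 2. [:2 * int n - 3 - int j, int j:])) (n - 1))"

end

theory Submission
  imports Defs
begin

text \<open>
  Write \<open>L d N = (\<Prod>j<N. d - j + j x)\<close> (\<open>linear_factors\<close> below), so that \<open>v n\<close> is the coefficient of \<open>x\<^sup>n\<^sup>-\<^sup>1\<close> in
  \<open>(1 - x) L (2n - 3) (2n - 2)\<close>. Modulo \<open>k\<close> the factors are periodic in \<open>j\<close>, and replacing \<open>j\<close> by
  \<open>-j\<close> gives \<open>L d k \<equiv> (-1)\<^sup>k L (-d) k\<close>; this relates \<open>v (m + 1)\<close> and \<open>v (m + 2)\<close> whenever \<open>k\<close>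
  divides \<open>2m\<close>.

  Modulo an odd prime \<open>p\<close>, comparing roots gives \<open>L d p \<equiv> - d S\<close> with
  \<open>S = x + x\<^sup>2 + \<dots> + x\<^sup>p\<^sup>-\<^sup>1\<close> (\<open>geom p\<close> below).
  Since \<open>(1 - x) S = (1 - x) (-1) - (x\<^sup>p - 1)\<close> and \<open>S\<^sup>p \<equiv> S(x\<^sup>p)\<close>, a coefficient of
  \<open>(1 - x) S\<^sup>c R\<close> with \<open>c \<ge> p\<close> is a sum of coefficients of \<open>(1 - x) S\<^sup>c\<^sup>-\<^sup>p R\<close> over a whole residue
  class modulo \<open>p\<close>, hence the same sum for \<open>(-1)\<^sup>c\<^sup>-\<^sup>p (1 - x) R\<close>. For \<open>c < p\<close> one uses instead
  \<open>(1 - x\<^sup>p) (1 - x) S\<^sup>c \<equiv> (1 - x)\<^sup>p\<^sup>+\<^sup>1\<^sup>-\<^sup>c (x - x\<^sup>p)\<^sup>c\<close>, where only two binomial terms contribute.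

  For \<open>d\<close> odd, shifting \<open>j\<close> by \<open>2\<^sup>q\<close> does not change a product of four consecutive factors modulo
  \<open>2\<^sup>q\<^sup>+\<^sup>1\<close>, so \<open>L d 2\<^sup>q\<^sup>+\<^sup>1 \<equiv> (L d 2\<^sup>q)\<^sup>2\<close>. Hence \<open>L d (2h) \<equiv> x\<^sup>h + h x\<^sup>h\<^sup>-\<^sup>2 G\<close> modulo
  \<open>2h = 2\<^sup>q\<close> with an explicit \<open>G\<close>, which gives \<open>v (n + h) \<equiv> v n + h\<close>; by
  induction on \<open>q\<close> this yields the period and the distribution of the residues.
\<close>

subsection \<open>Congruences of integer polynomials\<close>

text \<open>Divisibility by a constant polynomial suits products, and the coefficientwise form below
  serves to read off \<open>v\<close>; all moduli share one polynomial type.\<close>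

definition pcong :: "int \<Rightarrow> int poly \<Rightarrow> int poly \<Rightarrow> bool" where
  "pcong m f g \<longleftrightarrow> [:m:] dvd f - g"

lemma pcong_iff_coeff: "pcong m f g \<longleftrightarrow> (\<forall>i. [coeff f i = coeff g i] (mod m))"
  by (simp add: pcong_def const_poly_dvd_iff cong_iff_dvd_diff)

lemma pcong_coeff: "pcong m f g \<Longrightarrow> [coeff f i = coeff g i] (mod m)"
  by (simp add: pcong_iff_coeff)

lemma pcong_refl [simp]: "pcong m f f"
  by (simp add: pcong_def)

lemma pcong_sym: "pcong m f g \<Longrightarrow> pcong m g f"
  by (simp add: pcong_iff_coeff cong_sym)

lemma pcong_trans [trans]: "pcong m f g \<Longrightarrow> pcong m g h \<Longrightarrow> pcong m f h"
  by (meson cong_trans pcong_iff_coeff)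

lemma pcong_add: "pcong m f g \<Longrightarrow> pcong m f' g' \<Longrightarrow> pcong m (f + f') (g + g')"
  by (simp add: pcong_iff_coeff cong_add)

lemma pcong_mult:
  assumes "pcong m f g" "pcong m f' g'"
  shows "pcong m (f * f') (g * g')"
proof -
  have "f * f' - g * g' = (f - g) * f' + g * (f' - g')"
    by (simp add: algebra_simps)
  then show ?thesis
    using assms unfolding pcong_def by (metis dvd_add dvd_mult dvd_mult2)
qed

lemma pcong_power: "pcong m f g \<Longrightarrow> pcong m (f ^ n) (g ^ n)"
  by (induction n) (auto intro: pcong_mult)

lemma pcong_prod: "(\<And>i. i \<in> A \<Longrightarrow> pcong m (f i) (g i)) \<Longrightarrow> pcong m (\<Prod>i\<in>A. f i) (\<Prod>i\<in>A. g i)"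
  by (induction A rule: infinite_finite_induct) (auto intro: pcong_mult)

subsection \<open>Products of linear factors\<close>

text \<open>Decoupling \<open>d\<close> from \<open>N\<close> allows \<open>d\<close> to be replaced
  by any residue and the range of \<open>j\<close> to be cut into periods.\<close>

definition linear_factors :: "int \<Rightarrow> nat \<Rightarrow> int poly" where
  "linear_factors d N = (\<Prod>j<N. [:d - int j, int j:])"

lemma v_eq_coeff:
  "n \<ge> 1 \<Longrightarrow> v n = coeff ([:1, -1:] * linear_factors (2 * int n - 3) (2 * n - 2)) (n - 1)"
  by (simp add: v_def linear_factors_def)

lemma pcong_linear:
  "[a = b] (mod m) \<Longrightarrow> [i = j] (mod m) \<Longrightarrow> pcong m [:a - i, i:] [:b - j, j:]"
  by (auto simp: pcong_iff_coeff coeff_pCons split: nat.splits intro: cong_diff)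

lemma linear_factors_cong: "[a = b] (mod m) \<Longrightarrow> pcong m (linear_factors a N) (linear_factors b N)"
  unfolding linear_factors_def by (intro pcong_prod pcong_linear) auto

lemma linear_factors_add:
  "linear_factors d (M + N) = linear_factors d M * (\<Prod>j<N. [:d - int (M + j), int (M + j):])"
proof (induction N)
  case (Suc N)
  then show ?case by (simp add: linear_factors_def mult_ac)
qed (simp add: linear_factors_def)

lemma linear_factors_add_period:
  "pcong (int k) (linear_factors d (k + N)) (linear_factors d k * linear_factors d N)"
  unfolding linear_factors_add unfolding linear_factors_def
  by (intro pcong_mult pcong_refl pcong_prod pcong_linear) (auto simp: cong_def)

lemma linear_factors_period:
  "pcong (int k) (linear_factors d (k * c + r)) (linear_factors d k ^ c * linear_factors d r)"
proof (induction c)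
  case (Suc c)
  have "pcong (int k) (linear_factors d (k + (k * c + r)))
          (linear_factors d k * linear_factors d (k * c + r))"
    by (rule linear_factors_add_period)
  also have "pcong (int k) \<dots> (linear_factors d k * (linear_factors d k ^ c * linear_factors d r))"
    by (intro pcong_mult pcong_refl Suc)
  finally show ?case by (simp add: algebra_simps)
qed simp

text \<open>Entry point for a modulus \<open>k\<close>: \<open>c\<close> full periods and
  \<open>r\<close> leftover factors, with \<open>d\<close> any convenient representative of
  \<open>2 * n - 3\<close>.\<close>

lemma v_cong_coeff:
  assumes "n \<ge> 1" "2 * n - 2 = k * c + r" "[2 * int n - 3 = d] (mod int k)"
  shows "[v n = coeff ([:1, -1:] * (linear_factors d k ^ c * linear_factors d r)) (n - 1)]
      (mod int k)"
proof -
  have "pcong (int k) (linear_factors (2 * int n - 3) (2 * n - 2)) (linear_factors d (k * c + r))"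
    unfolding assms(2) by (rule linear_factors_cong) fact
  also have "pcong (int k) \<dots> (linear_factors d k ^ c * linear_factors d r)"
    by (rule linear_factors_period)
  finally show ?thesis
    unfolding v_eq_coeff[OF assms(1)] by (intro pcong_coeff pcong_mult pcong_refl)
qed

section \<open>Reflection of the index and the statements for arbitrary moduli\<close>

lemma linear_factors_reflect:
  assumes "k \<ge> 1"
  shows "pcong (int k) (linear_factors d k) ((-1) ^ k * linear_factors (-d) k)"
proof -
  \<comment> \<open>This represents \<open>- j\<close> modulo \<open>k\<close>; the outer
    \<open>mod\<close> sends \<open>0\<close> to \<open>0\<close> instead of
    \<open>k\<close>.\<close>
  define \<pi> where "\<pi> j = (k - j) mod k" for j
  have "bij_betw \<pi> {..<k} {..<k}"
    by (rule bij_betw_byWitness[where f' = \<pi>])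
       (use assms in \<open>auto simp: \<pi>_def mod_if\<close>)
  then have "linear_factors d k = (\<Prod>j<k. [:d - int (\<pi> j), int (\<pi> j):])"
    unfolding linear_factors_def by (rule prod.reindex_bij_betw[symmetric])
  also have "pcong (int k) \<dots> (\<Prod>j<k. [:d - (- int j), - int j:])"
  proof (intro pcong_prod pcong_linear cong_refl)
    fix j assume "j \<in> {..<k}"
    then show "[int (\<pi> j) = - int j] (mod int k)"
      by (cases "j = 0") (auto simp: \<pi>_def cong_iff_dvd_diff)
  qed
  also have "(\<Prod>j<k. [:d - (- int j), - int j:]) = (\<Prod>j<k. (-1) * [:(-d) - int j, int j:])"
    by (intro prod.cong) auto
  also have "\<dots> = (-1) ^ k * linear_factors (-d) k"
    unfolding linear_factors_def prod.distrib by simp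
  finally show ?thesis .
qed

text \<open>Let \<open>2 * m = k * c\<close>. Modulo \<open>k\<close>, \<open>v (m + 1)\<close> has
  \<open>d = -1\<close> and \<open>c\<close> full periods, while \<open>v (m + 2)\<close> has
  \<open>d = 1\<close> and two further factors, 1 and x. Reflection exchanges the two values of
  \<open>d\<close>, and the factor x accounts for the shift of the coefficient index.\<close>

lemma v_Suc_cong:
  assumes "k \<ge> 1" "k dvd 2 * m"
  shows "[v (m + 1) = v (m + 2)] (mod int k)"
proof -
  obtain c where c: "2 * m = k * c" using assms(2) by blast
  have kd: "int k dvd 2 * int m"
  proof -
    have "int k dvd int (2 * m)" using assms(2) by (simp only: of_nat_dvd_iff)
    then show ?thesis by simp
  qed
  have "pcong (int k) (linear_factors 1 k ^ c) (((-1) ^ k * linear_factors (-1) k) ^ c)"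
    by (intro pcong_power linear_factors_reflect) (use assms in auto)
  \<comment> \<open>The total sign is \<open>(-1) ^ (k * c)\<close>, and
    \<open>k * c = 2 * m\<close> is even.\<close>
  also have "((-1) ^ k * linear_factors (-1) k) ^ c = linear_factors (-1) k ^ c"
  proof (cases "even k")
    case False
    have "even (k * c)" unfolding c[symmetric] by simp
    with False have "even c" by simp
    with False show ?thesis by simp
  qed simp
  finally have eq: "pcong (int k) (linear_factors 1 k ^ c) (linear_factors (-1) k ^ c)" .
  have "[v (m + 2) = coeff ([:1, -1:] * (linear_factors 1 k ^ c * linear_factors 1 2))
      (m + 2 - 1)] (mod int k)"
    by (rule v_cong_coeff) (use c kd in \<open>auto simp: cong_iff_dvd_diff\<close>)
  also have "[coeff ([:1, -1:] * (linear_factors 1 k ^ c * linear_factors 1 2)) (m + 2 - 1)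
      = coeff ([:1, -1:] * (linear_factors (-1) k ^ c * linear_factors 1 2)) (m + 2 - 1)]
          (mod int k)"
    by (intro pcong_coeff pcong_mult pcong_refl eq)
  also have "linear_factors 1 2 = monom 1 1"
    by (simp add: linear_factors_def numeral_2_eq_2 monom_altdef)
  also have "[:1, -1:] * (linear_factors (-1) k ^ c * monom 1 1)
      = monom 1 1 * ([:1, -1:] * linear_factors (-1) k ^ c)"
    by (simp only: mult_ac)
  also have "coeff (monom 1 1 * ([:1, -1:] * linear_factors (-1) k ^ c)) (m + 2 - 1)
      = coeff ([:1, -1:] * (linear_factors (-1) k ^ c * linear_factors (-1) 0)) m"
    by (subst coeff_monom_mult) (simp add: linear_factors_def)
  also have "[coeff ([:1, -1:] * (linear_factors (-1) k ^ c * linear_factors (-1) 0)) m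
      = v (m + 1)] (mod int k)"
  proof (rule cong_sym)
    have "[v (m + 1) = coeff ([:1, -1:] * (linear_factors (-1) k ^ c * linear_factors (-1) 0))
        (m + 1 - 1)] (mod int k)"
    proof (rule v_cong_coeff)
      show "[2 * int (m + 1) - 3 = -1] (mod int k)"
        using kd by (simp add: cong_iff_dvd_diff)
    qed (simp_all add: c[symmetric])
    then show "[v (m + 1) = coeff ([:1, -1:] * (linear_factors (-1) k ^ c *
        linear_factors (-1) 0)) m] (mod int k)"
      by simp
  qed
  finally show ?thesis by (rule cong_sym)
qed

text \<open>The factor with \<open>j = 0\<close> is the constant \<open>2 * n - 3\<close>.\<close>

lemma v_cong_0:
  assumes "n \<ge> 2" "k dvd 2 * int n - 3"
  shows "[v n = 0] (mod k)"
proof -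
  define r where "r = 2 * n - 3"
  have "2 * n - 2 = 1 + r"
    using assms by (simp add: r_def)
  then have "linear_factors (2 * int n - 3) (2 * n - 2) = linear_factors (2 * int n - 3) (1 + r)"
    by (rule arg_cong)
  also have "pcong k \<dots> 0"
    unfolding linear_factors_add using assms(2)
    by (simp add: pcong_def linear_factors_def const_poly_dvd_iff coeff_pCons split: nat.splits)
  finally show ?thesis
    using assms v_eq_coeff[of n] pcong_coeff[OF pcong_mult[OF pcong_refl], of k _ 0 "[:1,-1:]"]
        by simp
qed

text \<open>Modulo 2 the factor is 1 for even \<open>j\<close> and x for odd
  \<open>j\<close>.\<close>

lemma linear_factors_cong_2: "odd d \<Longrightarrow> pcong 2 (linear_factors d (2 * m)) (monom 1 m)"
proof (induction m)
  case (Suc m)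
  have "linear_factors d (2 * Suc m) =
      linear_factors d (2 * m) * ([:d - int (2 * m), int (2 * m):] * [:d - int (2 * m + 1),
          int (2 * m + 1):])"
    unfolding linear_factors_def
    by (simp only: mult_Suc_right add_2_eq_Suc prod.lessThan_Suc mult.assoc flip: Suc_eq_plus1)
  also have "pcong 2 \<dots> (monom 1 m * ([:1 - 0, 0:] * [:1 - 1, 1:]))"
    by (intro pcong_mult pcong_linear Suc.IH Suc.prems)
       (use Suc.prems in \<open>auto simp: cong_iff_dvd_diff\<close>)
  also have "monom 1 m * ([:1 - 0, 0:] * [:1 - 1, 1:]) = (monom 1 (Suc m) :: int poly)"
    by (simp add: monom_Suc)
  finally show ?case .
qed (simp add: linear_factors_def)

lemma odd_v:
  assumes "n \<ge> 1"
  shows "odd (v n)"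
proof -
  have "2 * n - 2 = 2 * (n - 1)" by simp
  then have "pcong 2 ([:1, -1:] * linear_factors (2 * int n - 3) (2 * n - 2))
      ([:1, -1:] * monom 1 (n - 1))"
    by (simp only:) (intro pcong_mult pcong_refl linear_factors_cong_2, simp)
  then have "[v n = coeff ([:1, -1:] * monom 1 (n - 1)) (n - 1)] (mod 2)"
    unfolding v_eq_coeff[OF assms] by (rule pcong_coeff)
  also have "[:1, -1:] * monom 1 (n - 1) = monom 1 (n - 1) * [:1, -1 :: int:]"
    by (rule mult.commute)
  also have "coeff \<dots> (n - 1) = 1" by (subst coeff_monom_mult) simp
  finally show ?thesis by (simp add: cong_iff_dvd_diff)
qed

subsection \<open>Prime moduli\<close>

lemma pcong_const_dvd:
  assumes "[poly f a = 0] (mod m)"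
  shows "pcong m f ([:-a, 1:] * synthetic_div f a)"
proof -
  have "f - [:-a, 1:] * synthetic_div f a = [:poly f a:]"
    using synthetic_div_correct'[of a f] by (metis add_diff_cancel_left')
  with assms show ?thesis
    by (simp add: pcong_def const_poly_dvd_const_poly_iff cong_0_iff)
qed

lemma poly_cong: "pcong m f g \<Longrightarrow> [poly f a = poly g a] (mod m)"
  by (auto simp: pcong_def cong_iff_dvd_diff simp flip: poly_diff elim!: dvdE)

text \<open>Splitting off x - a leaves a quotient that vanishes at every other point
  \<open>b\<close>, since the prime \<open>p\<close> does not divide \<open>b - a\<close>.\<close>

lemma pcong_0_if_many_roots:
  fixes p :: int
  assumes "prime p" "finite A" "degree f < card A"
    and "\<And>a. a \<in> A \<Longrightarrow> [poly f a = 0] (mod p)"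
    and "\<And>a b. a \<in> A \<Longrightarrow> b \<in> A \<Longrightarrow> [a = b] (mod p) \<Longrightarrow> a = b"
  shows "pcong p f 0"
  using assms(2-)
proof (induction A arbitrary: f rule: finite_induct)
  case (insert a A)
  define g where "g = synthetic_div f a"
  have f: "pcong p f ([:-a, 1:] * g)"
    unfolding g_def by (rule pcong_const_dvd) (use insert.prems in auto)
  have "pcong p g 0"
  \<comment> \<open>A constant \<open>f\<close> leaves no room for \<open>degree g < card A\<close>
    in the induction hypothesis, but then \<open>g = 0\<close>.\<close>
  proof (cases "A = {}")
    case True
    then have "degree f = 0" using insert by simp
    then have "g = 0" by (auto simp: g_def synthetic_div_eq_0_iff)
    then show ?thesis by simp
  next
    case False
    show ?thesis
    proof (rule insert.IH)
      show "degree g < card A"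
      proof -
        have "card A > 0" using False insert.hyps by (simp add: card_gt_0_iff)
        then show ?thesis
          using insert.prems(1) insert.hyps by (simp add: g_def degree_synthetic_div)
      qed
      fix b assume b: "b \<in> A"
      have "[poly f b = (b - a) * poly g b] (mod p)"
        using poly_cong[OF f, of b] by (simp add: algebra_simps)
      then have "p dvd (b - a) * poly g b"
        using insert.prems(2)[of b] b by (metis cong_0_iff cong_dvd_iff insertCI)
      moreover have "\<not> p dvd b - a"
        using insert.prems(3)[of b a] insert.hyps b by (auto simp: cong_iff_dvd_diff)
      ultimately show "[poly g b = 0] (mod p)"
        using \<open>prime p\<close> by (simp add: prime_dvd_mult_iff cong_0_iff)
    qed (use insert.prems in auto)
  qed
  then have "pcong p ([:-a, 1:] * g) ([:-a, 1:] * 0)"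
    by (intro pcong_mult pcong_refl)
  with f show ?case by (metis pcong_trans mult_zero_right)
qed simp

text \<open>Modulo a prime \<open>p\<close> its value is -1 at 1 and, by Fermat, 0 at all other
  residues, which is the value pattern of a full period up to a scalar.\<close>

definition geom :: "nat \<Rightarrow> int poly" where
  "geom p = (\<Sum>i = 1..<p. monom 1 i)"

lemma coeff_geom: "coeff (geom p) n = (if 1 \<le> n \<and> n < p then 1 else 0)"
  by (simp add: geom_def coeff_sum)

lemma one_minus_x_times_geom:
  assumes "p \<ge> 1"
  shows "[:1, -1:] * geom p = monom 1 1 - monom 1 p"
proof (rule poly_eqI)
  fix n show "coeff ([:1, -1:] * geom p) n = coeff (monom 1 1 - monom 1 p) n"
    using assms by (cases n) (auto simp: coeff_geom)
qed

text \<open>Modulo x^p - 1, multiplication by \<open>geom p\<close> sends 1 - x to its negative. The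
  quotient \<open>h\<close> keeps the identity exact, because multiples of x^p - 1 telescope along
  residue classes.\<close>

lemma geom_mod:
  assumes "p \<ge> 1"
  shows "\<exists>h. [:1, -1:] * geom p ^ e = (-1) ^ e * [:1, -1:] + (monom 1 p - 1) * h"
proof (induction e)
  case 0
  show ?case by (rule exI[of _ 0]) simp
next
  case (Suc e)
  then obtain h where h: "[:1, -1:] * geom p ^ e
      = (-1) ^ e * [:1, -1:] + (monom 1 p - 1) * h" by blast
  have x: "monom 1 1 - 1 = - [:1, -1 :: int:]"
    by (simp add: monom_altdef one_pCons)
  have "[:1, -1:] * geom p ^ Suc e = geom p * ([:1, -1:] * geom p ^ e)"
    by (simp only: power_Suc mult_ac)
  also have "\<dots> = (-1) ^ e * ([:1, -1:] * geom p) + (monom 1 p - 1) * (geom p * h)"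
    unfolding h by (simp only: ring_distribs mult_ac)
  also have "[:1, -1:] * geom p = (monom 1 1 - 1) - (monom 1 p - 1)"
    unfolding one_minus_x_times_geom[OF assms] by simp
  also have "(-1) ^ e * ((monom 1 1 - 1) - (monom 1 p - 1)) + (monom 1 p - 1) * (geom p * h)
      = (-1) ^ Suc e * [:1, -1:] + (monom 1 p - 1) * (geom p * h - (-1) ^ e)"
    unfolding x by (simp only: power_Suc ring_distribs) (simp add: algebra_simps)
  finally show ?case by blast
qed

lemma poly_linear_factors: "poly (linear_factors d N) c = (\<Prod>j<N. d + int j * (c - 1))"
  by (simp add: linear_factors_def poly_prod algebra_simps)

text \<open>The factor with \<open>j = 0\<close> is constant, whence the \<open>- 1\<close>; it
  makes \<open>p\<close> evaluation points enough in \<open>linear_factors_prime\<close>.\<close>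

lemma degree_linear_factors: "degree (linear_factors d N) \<le> N - 1"
proof -
  have "degree (linear_factors d N) \<le> (\<Sum>j<N. degree [:d - int j, int j:])"
    unfolding linear_factors_def by (rule order.trans[OF degree_prod_sum_le]) auto
  also have "\<dots> = (\<Sum>j\<in>{..<N} - {0}. degree [:d - int j, int j:])"
    by (intro sum.mono_neutral_right) auto
  also have "\<dots> = (\<Sum>j\<in>{..<N} - {0}. 1)"
    by (intro sum.cong) auto
  also have "\<dots> \<le> N - 1"
    by (cases N) (auto simp: card_Diff_singleton_if)
  finally show ?thesis .
qed

lemma power_prime_cong_int:
  fixes b :: int
  assumes "prime p"
  shows "[b ^ p = b] (mod int p)"
proof -
  have p: "p > 0" using assms by (rule prime_gt_0_nat)
  define n where "n = nat (b mod int p)"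
  have b: "[b = int n] (mod int p)"
    using p by (simp add: n_def)
  have "[n ^ p = n] (mod p)"
  proof (cases "p dvd n")
    case True
    moreover have "p dvd n ^ p" using dvd_trans[OF True dvd_power[of p n]] p by simp
    ultimately show ?thesis by (metis cong_0_iff cong_sym cong_trans)
  next
    case False
    then have "[n ^ (p - 1) * n = 1 * n] (mod p)"
      using fermat_theorem[OF assms] by (intro cong_mult cong_refl)
    then show ?thesis using p by (simp flip: power_Suc2)
  qed
  then have n: "[int n ^ p = int n] (mod int p)"
    by (metis cong_int_iff of_nat_power)
  have "[b ^ p = int n ^ p] (mod int p)" using b by (rule cong_pow)
  also note n
  also note cong_sym[OF b]
  finally show ?thesis .
qed

text \<open>Both sides have degree below \<open>p\<close>, so agreement at all \<open>p\<close>
  residues suffices. At 1 every factor equals \<open>d\<close> and Fermat applies; elsewhere both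
  sides vanish.\<close>

lemma linear_factors_prime:
  assumes "prime p"
  shows "pcong (int p) (linear_factors d p) (smult (-d) (geom p))"
proof -
  let ?f = "linear_factors d p - smult (-d) (geom p)"
  have p: "p \<ge> 2" using assms by (rule prime_ge_2_nat)
  have "pcong (int p) ?f 0"
  proof (rule pcong_0_if_many_roots[where A = "int ` {..<p}"])
    show "prime (int p)" using assms by simp
    have "degree (geom p) \<le> p - 1"
      by (intro degree_le) (auto simp: coeff_geom)
    then have "degree ?f \<le> p - 1"
      by (intro degree_diff_le degree_linear_factors) (auto intro: order.trans[OF degree_smult_le])
    then show "degree ?f < card (int ` {..<p})"
      using p by (simp add: card_image)
    show "a = b" if "a \<in> int ` {..<p}" "b \<in> int ` {..<p}" "[a = b] (mod int p)" for a b
      using that by (auto simp: cong_def simp flip: of_nat_mod)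
  next
    fix a assume a: "a \<in> int ` {..<p}"
    have g: "(1 - a) * poly (geom p) a = a - a ^ p"
      using arg_cong[OF one_minus_x_times_geom[of p], of "\<lambda>f. poly f a"] p
      by (simp add: poly_monom left_diff_distrib)
    note fermat = power_prime_cong_int[OF \<open>prime p\<close>]
    show "[poly ?f a = 0] (mod int p)"
    proof (cases "a = 1")
      case True
      have geom_1: "poly (geom p) 1 = int p - 1"
        using p by (simp add: geom_def poly_sum poly_monom)
      have "poly ?f a = d ^ p + d * poly (geom p) 1"
        by (simp add: True poly_linear_factors)
      also have "\<dots> = (d ^ p - d) + d * int p"
        unfolding geom_1 by (simp add: algebra_simps)
      also have "int p dvd \<dots>"
        using fermat[of d] by (simp add: cong_iff_dvd_diff)
      finally show ?thesis by (simp add: cong_0_iff)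
    next
      case False
      then have nd: "\<not> int p dvd a - 1"
        using a p cong_less_imp_eq_int[of a "int p" 1] by (auto simp: cong_iff_dvd_diff)
      then have "int p dvd (1 - a) * poly (geom p) a"
        unfolding g using fermat[of a] by (metis cong_iff_dvd_diff cong_sym)
      then have 1: "int p dvd poly (geom p) a"
        using nd assms by (metis dvd_minus_iff minus_diff_eq prime_dvd_mult_iff
            prime_nat_int_transfer)
      have "coprime (a - 1) (int p)"
        using nd assms by (metis coprime_commute prime_imp_coprime prime_nat_int_transfer)
      then obtain y where "[(a - 1) * y = 1] (mod int p)"
        using cong_solve_coprime_int by blast
      then have y: "[(a - 1) * y * (- d) = 1 * (- d)] (mod int p)"
        by (intro cong_mult cong_refl)
      \<comment> \<open>As \<open>y\<close> inverts \<open>a - 1\<close>, this \<open>j\<close>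
        solves \<open>d + j * (a - 1) = 0\<close> modulo \<open>p\<close>: the factor of index
        \<open>j\<close> vanishes at \<open>a\<close>.\<close>
      define j where "j = nat ((y * (- d)) mod int p)"
      have j: "j < p" "int j = (y * (- d)) mod int p"
        using p by (auto simp: j_def nat_less_iff)
      have "[d + int j * (a - 1) = d + (y * (- d)) * (a - 1)] (mod int p)"
        unfolding j by (intro cong_add cong_mult cong_refl) simp
      also have "[d + (y * (- d)) * (a - 1) = d + 1 * (- d)] (mod int p)"
        using y by (intro cong_add cong_refl) (simp only: mult_ac)
      finally have "int p dvd d + int j * (a - 1)"
        by (simp add: cong_0_iff)
      also have "\<dots> dvd poly (linear_factors d p) a"
        unfolding poly_linear_factors using j by (intro dvd_prodI) auto
      finally show ?thesis using 1 by (simp add: cong_0_iff)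
    qed
  qed auto
  then show ?thesis by (simp add: pcong_def)
qed

section \<open>Frobenius and coefficients of high powers of \<open>geom p\<close>\<close>

lemma pcong_power_prime_add:
  assumes "prime p"
  shows "pcong (int p) ((f + g) ^ p) (f ^ p + g ^ p)"
proof -
  have p: "p > 0" using assms by (rule prime_gt_0_nat)
  have "(f + g) ^ p = (\<Sum>k\<le>p. of_nat (p choose k) * f ^ k * g ^ (p - k))"
    by (rule binomial_ring)
  also have "{..p} = insert 0 (insert p {0<..<p})"
    using p by auto
  also have "(\<Sum>k\<in>\<dots>. of_nat (p choose k) * f ^ k * g ^ (p - k))
      = f ^ p + g ^ p + (\<Sum>k\<in>{0<..<p}. of_nat (p choose k) * f ^ k * g ^ (p - k))"
    using p by simp
  finally have "(f + g) ^ p - (f ^ p + g ^ p)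
      = (\<Sum>k\<in>{0<..<p}. of_nat (p choose k) * f ^ k * g ^ (p - k))"
    by simp
  also have "[:int p:] dvd \<dots>"
  proof (intro dvd_sum dvd_mult2)
    fix k assume "k \<in> {0<..<p}"
    then have "p dvd (p choose k)" using assms by (intro dvd_choose_prime) auto
    then show "[:int p:] dvd of_nat (p choose k)"
      by (auto simp: of_nat_poly)
  qed
  finally show ?thesis by (simp add: pcong_def)
qed

lemma pcong_power_prime_sum:
  assumes "prime p" "finite A"
  shows "pcong (int p) ((\<Sum>i\<in>A. f i) ^ p) (\<Sum>i\<in>A. f i ^ p)"
  using assms(2)
proof (induction A rule: finite_induct)
  case (insert a A)
  have "pcong (int p) ((f a + sum f A) ^ p) (f a ^ p + sum f A ^ p)"
    by (rule pcong_power_prime_add) fact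
  also have "pcong (int p) \<dots> (f a ^ p + (\<Sum>i\<in>A. f i ^ p))"
    by (intro pcong_add pcong_refl insert.IH)
  finally show ?case using insert.hyps by simp
qed (use assms prime_gt_0_nat in \<open>auto simp: power_0_left\<close>)

lemma geom_power_prime:
  assumes "prime p"
  shows "pcong (int p) (geom p ^ p) (\<Sum>i = 1..<p. monom 1 (p * i))"
  using pcong_power_prime_sum[OF assms, of "{1..<p}" "monom 1"]
  by (simp add: geom_def monom_power mult.commute)

text \<open>The coefficient at i is \<open>coeff h (i - p) - coeff h i\<close>, without the first
  term if \<open>i < p\<close>; by \<open>r < p\<close> this is how the sum starts.\<close>

lemma sum_coeff_telescope:
  fixes h :: "int poly"
  assumes "r < p"
  shows "(\<Sum>s<Suc K. coeff ((monom 1 p - 1) * h) (r + p * s)) = - coeff h (r + p * K)"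
proof (induction K)
  case (Suc K)
  then show ?case
    by (subst sum.lessThan_Suc) (simp add: left_diff_distrib coeff_monom_mult)
qed (use assms in \<open>simp add: left_diff_distrib coeff_monom_mult\<close>)

text \<open>
  The bounds on \<open>N\<close> ensure that multiplying by \<open>S(x\<^sup>p)\<close> collects every nonzero coefficient of
  \<open>(1 - x) S\<^sup>c\<^sup>-\<^sup>p R\<close> whose index is congruent to \<open>N\<close> modulo \<open>p\<close>.
\<close>
lemma coeff_geom_power_cong:
  fixes R :: "int poly"
  assumes "prime p" "p \<le> c" "degree R + 1 < p"
    and "1 + (c - p) * (p - 1) + degree R < N" "N < p\<^sup>2 + (c - p)"
  shows "[coeff ([:1, -1:] * geom p ^ c * R) N
      = (-1) ^ (c - p) * coeff ([:1, -1:] * R) (N mod p)] (mod int p)"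
proof -
  have p: "p \<ge> 2" using \<open>prime p\<close> by (rule prime_ge_2_nat)
  \<comment> \<open>Frobenius spreads \<open>p\<close> of the \<open>c\<close> powers over multiples
    of \<open>p\<close>; the other \<open>e\<close> powers remain in \<open>g\<close>.\<close>
  define e where "e = c - p"
  define K where "K = N div p"
  define r where "r = N mod p"
  have N: "N = r + p * K" and r: "r < p"
    using p by (auto simp: K_def r_def)
  define g where "g = [:1, -1:] * geom p ^ e * R"
  define B where "B = [:1, -1:] * R"
  obtain h where h: "[:1, -1:] * geom p ^ e = (-1) ^ e * [:1, -1:] + (monom 1 p - 1) * h"
    using geom_mod[of p e] p by auto
  have g_eq: "g - (-1) ^ e * B = (monom 1 p - 1) * (h * R)"
    unfolding g_def B_def h by (simp only: ring_distribs mult_ac)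
  have "degree (geom p ^ e) \<le> e * (p - 1)"
    by (rule order.trans[OF degree_power_le]) (auto intro!: degree_le simp: coeff_geom)
  then have deg_g: "degree g < N"
    using assms(4) unfolding g_def e_def[symmetric]
    by (intro le_less_trans[OF degree_mult_le] le_less_trans[OF add_mono[OF degree_mult_le
        order.refl]]) auto
  have deg_B: "degree B \<le> degree R + 1"
    unfolding B_def by (rule order.trans[OF degree_mult_le]) simp
  have low_g: "coeff g t = 0" if "t < e" for t
  proof -
    have "geom p = monom 1 1 * (\<Sum>i = 1..<p. monom 1 (i - 1))"
      unfolding geom_def sum_distrib_left by (intro sum.cong) (auto simp: mult_monom)
    then have "g = monom 1 e * ([:1, -1:] * (\<Sum>i = 1..<p. monom 1 (i - 1)) ^ e * R)"
      unfolding g_def by (simp only: power_mult_distrib monom_power power_one mult_1 mult_ac)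
    with that show ?thesis by (simp add: coeff_monom_mult)
  qed
  have "pcong (int p) ([:1, -1:] * geom p ^ c * R)
      ([:1, -1:] * ((\<Sum>b = 1..<p. monom 1 (p * b)) * geom p ^ e) * R)"
    using assms(2) unfolding e_def
    by (subst le_add_diff_inverse[OF assms(2), symmetric], subst power_add)
       (intro pcong_mult pcong_refl geom_power_prime \<open>prime p\<close>)
  also have "[:1, -1:] * ((\<Sum>b = 1..<p. monom 1 (p * b)) * geom p ^ e) * R
      = (\<Sum>b = 1..<p. monom 1 (p * b) * g)"
    unfolding g_def sum_distrib_right[symmetric] by (simp only: mult_ac)
  finally have "[coeff ([:1, -1:] * geom p ^ c * R) N
      = coeff (\<Sum>b = 1..<p. monom 1 (p * b) * g) N] (mod int p)"
    by (rule pcong_coeff)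
  also have "coeff (\<Sum>b = 1..<p. monom 1 (p * b) * g) N
      = (\<Sum>b = 1..<p. if b \<le> K then coeff g (N - p * b) else 0)"
  proof (subst coeff_sum, intro sum.cong refl)
    fix b
    have "N < p * b \<longleftrightarrow> K < b"
      using p unfolding K_def by (metis div_less_iff_less_mult mult.commute gr0I
          not_numeral_le_zero)
    then show "coeff (monom 1 (p * b) * g) N = (if b \<le> K then coeff g (N - p * b) else 0)"
      by (simp add: coeff_monom_mult)
  qed
  also have "\<dots> = (\<Sum>b\<in>{1..<p} \<inter> {..K}. coeff g (N - p * b))"
    by (subst sum.inter_restrict) auto
  \<comment> \<open>The range of \<open>b\<close> is completed to a whole residue class:
    \<open>b = 0\<close> asks for a coefficient beyond the degree of \<open>g\<close>, and
    \<open>b \<ge> p\<close> for one of index below \<open>e\<close>, while x^e divides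
    \<open>g\<close>.\<close>
  also have "\<dots> = (\<Sum>b\<in>{..K}. coeff g (N - p * b))"
  proof (rule sum.mono_neutral_left)
    show "\<forall>b\<in>{..K} - {1..<p} \<inter> {..K}. coeff g (N - p * b) = 0"
    proof
      fix b assume "b \<in> {..K} - {1..<p} \<inter> {..K}"
      then consider "b = 0" | "b \<ge> p" by fastforce
      then show "coeff g (N - p * b) = 0"
      proof cases
        case 1
        then show ?thesis using deg_g by (simp add: coeff_eq_0)
      next
        case 2
        then have "p\<^sup>2 \<le> p * b" by (simp add: power2_eq_square)
        show ?thesis
        \<comment> \<open>For \<open>e = 0\<close> divisibility by x^e says nothing, but then
          \<open>N < p\<^sup>2\<close> puts \<open>b \<ge> p\<close> out of range.\<close>
        proof (cases "e = 0")
          case True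
          then have "N < p * b" using assms(5) \<open>p\<^sup>2 \<le> p * b\<close> by (simp add: e_def)
          moreover have "p * b \<le> p * K" using \<open>b \<in> {..K} - _\<close> by simp
          ultimately show ?thesis using N by simp
        next
          case False
          then show ?thesis
            using assms(5) \<open>p\<^sup>2 \<le> p * b\<close> by (intro low_g) (simp add: e_def)
        qed
      qed
    qed
  qed auto
  also have "\<dots> = (\<Sum>s<Suc K. coeff g (r + p * s))"
    by (rule sum.reindex_bij_witness[where i = "\<lambda>s. K - s" and j = "\<lambda>s. K - s"])
       (auto simp: N algebra_simps simp flip: diff_mult_distrib2)
  also have "\<dots> = (\<Sum>s<Suc K. coeff ((monom 1 p - 1) * (h * R)) (r + p * s)
      + (-1) ^ e * coeff B (r + p * s))"
  proof (intro sum.cong refl)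
    fix s
    have "g = (monom 1 p - 1) * (h * R) + smult ((-1) ^ e) B"
      unfolding g_eq[symmetric] by (cases "even e") simp_all
    then show "coeff g (r + p * s) = coeff ((monom 1 p - 1) * (h * R)) (r + p * s)
        + (-1) ^ e * coeff B (r + p * s)"
      by simp
  qed
  also have "\<dots> = (\<Sum>s<Suc K. coeff ((monom 1 p - 1) * (h * R)) (r + p * s))
      + (-1) ^ e * (\<Sum>s<Suc K. coeff B (r + p * s))"
    by (simp only: sum.distrib sum_distrib_left)
  also have "(\<Sum>s<Suc K. coeff ((monom 1 p - 1) * (h * R)) (r + p * s)) = - coeff (h * R) N"
    unfolding sum_coeff_telescope[OF r] N[symmetric] ..
  \<comment> \<open>The product of \<open>h * R\<close> with x^p - 1 is
    \<open>g - (-1) ^ e * B\<close>, of degree below \<open>N\<close>; hence \<open>h * R\<close>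
    has degree below \<open>N\<close> too.\<close>
  also have "coeff (h * R) N = 0"
  proof (rule coeff_eq_0)
    have 0: "monom 1 p - 1 \<noteq> (0 :: int poly)"
    proof
      assume "monom 1 p - 1 = (0 :: int poly)"
      then have "coeff (monom 1 p - 1 :: int poly) 0 = 0" by simp
      then show False using p by simp
    qed
    have "degree B < N" using deg_B assms(4) by linarith
    then have "degree (g - (-1) ^ e * B) < N"
      using deg_g by (cases "even e") (auto intro!: degree_diff_less degree_add_less)
    then show "degree (h * R) < N"
      unfolding g_eq using 0 by (cases "h * R = 0") (auto simp: degree_mult_eq)
  qed
  also have "(\<Sum>s<Suc K. coeff B (r + p * s)) = (\<Sum>s\<in>{0}. coeff B (r + p * s))"
  proof (rule sum.mono_neutral_right)
    show "\<forall>s\<in>{..<Suc K} - {0}. coeff B (r + p * s) = 0"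
    proof
      fix s assume "s \<in> {..<Suc K} - {0}"
      then have "p \<le> p * s" by simp
      then show "coeff B (r + p * s) = 0"
        using deg_B assms(3) by (intro coeff_eq_0) linarith
    qed
  qed auto
  finally show ?thesis by (simp add: e_def B_def r_def)
qed

section \<open>Vanishing entries modulo a prime\<close>

lemma v_prime_cong_coeff:
  assumes "prime p" "n \<ge> 1" "2 * n - 2 = p * c + r" "[2 * int n - 3 = d] (mod int p)"
  shows "[v n = (-d) ^ c * coeff ([:1, -1:] * geom p ^ c * linear_factors d r) (n - 1)] (mod int p)"
proof -
  have "[v n = coeff ([:1, -1:] * (linear_factors d p ^ c * linear_factors d r)) (n - 1)]
      (mod int p)"
    by (rule v_cong_coeff) fact+
  also have "[coeff ([:1, -1:] * (linear_factors d p ^ c * linear_factors d r)) (n - 1)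
      = coeff ([:1, -1:] * (smult (-d) (geom p) ^ c * linear_factors d r)) (n - 1)] (mod int p)"
    by (intro pcong_coeff pcong_mult pcong_power pcong_refl linear_factors_prime \<open>prime p\<close>)
  also have "[:1, -1:] * (smult (-d) (geom p) ^ c * linear_factors d r)
      = smult ((-d) ^ c) ([:1, -1:] * geom p ^ c * linear_factors d r)"
    unfolding smult_power by (simp only: mult_smult_left mult_smult_right mult.assoc)
  finally show ?thesis by simp
qed

text \<open>Here \<open>2 * n - 2 = p * (2 * l + 1) + D\<close>, and the \<open>D\<close> leftover
  factors give \<open>R\<close> of degree at most \<open>D - 1\<close>, so (1 - x) R has degree
  below \<open>i - 1\<close>. For large \<open>l\<close> the exponent \<open>2 * l + 1\<close> is at
  least \<open>p\<close>, and the coefficient reduces to that of (1 - x) R at \<open>i - 1\<close>.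
  For \<open>l = 0\<close> the identity for (1 - x) \<open>geom p\<close> is enough.\<close>

lemma v_prime_upper:
  assumes "prime p" "p > 2" "(p + 3) div 2 \<le> i" "i \<le> p" "l = 0 \<or> (p - 1) div 2 \<le> l" "l \<le> p"
  shows "[v (l * p + i) = 0] (mod int p)"
proof -
  have "odd p" using assms prime_odd_nat by blast
  then obtain m where m: "p = 2 * m + 1" by (elim oddE)
  have mi: "m + 2 \<le> i" using assms(3) by (simp add: m)
  define D where "D = 2 * i - 2 - p"
  define n where "n = l * p + i"
  have 1: "[v n = (- (int D - 1)) ^ (2 * l + 1) *
      coeff ([:1, -1:] * geom p ^ (2 * l + 1) * linear_factors (int D - 1) D) (n - 1)] (mod int p)"
  proof (rule v_prime_cong_coeff)
    show "2 * n - 2 = p * (2 * l + 1) + D"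
      using mi by (simp add: D_def n_def m algebra_simps)
    have "2 * int n - 3 - (int D - 1) = int p * (2 * int l + 1)"
      using mi by (simp add: D_def n_def m algebra_simps of_nat_diff)
    then show "[2 * int n - 3 = int D - 1] (mod int p)"
      by (simp add: cong_iff_dvd_diff)
  qed (use assms mi in \<open>auto simp: n_def\<close>)
  have 2: "[coeff ([:1, -1:] * geom p ^ (2 * l + 1) * linear_factors (int D - 1) D) (n - 1)
      = 0] (mod int p)"
  proof -
    define R where "R = linear_factors (int D - 1) D"
    have degR: "degree R \<le> D - 1" unfolding R_def by (rule degree_linear_factors)
    have D: "D + 1 < i" "D \<ge> 1" using assms mi by (auto simp: D_def m)
    show ?thesis
    proof (cases "l = 0")
      case True
      have "coeff ([:1, -1:] * geom p ^ (2 * l + 1) * R) (n - 1)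
          = coeff (monom 1 1 * R - monom 1 p * R) (i - 1)"
        using one_minus_x_times_geom[of p] assms by (simp add: True n_def left_diff_distrib)
      also have "\<dots> = coeff R (i - 2)"
        using assms mi by (simp add: coeff_monom_mult) (simp add: numeral_2_eq_2)
      also have "\<dots> = 0"
        using degR D by (intro coeff_eq_0) linarith
      finally show ?thesis unfolding R_def by simp
    next
      case False
      then have l: "m \<le> l" using assms by (simp add: m)
      \<comment> \<open>Both bounds on the index \<open>n - 1\<close> come down to this inequality;
        the substitutions below remove the natural subtractions.\<close>
      have "(l * (p - 2)) + i \<le> p * (p - 2) + p"
        using assms by (intro add_mono mult_right_mono) auto
      then have *: "l * (2 * m - 1) + i \<le> (2 * m + 1) * (2 * m - 1) + 2 * m + 1"
        by (simp add: m)
      obtain t where t: "l = m + t" using l le_Suc_ex by blast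
      obtain m' where m': "m = Suc m'" using assms m by (cases m) auto
      have "[coeff ([:1, -1:] * geom p ^ (2 * l + 1) * R) (n - 1)
          = (-1) ^ (2 * l + 1 - p) * coeff ([:1, -1:] * R) ((n - 1) mod p)] (mod int p)"
      proof (rule coeff_geom_power_cong)
        show "degree R + 1 < p" using degR D assms by linarith
        have "1 + (2 * l + 1 - p) * (p - 1) + D < n"
          using * mi by (simp add: m t m' n_def D_def algebra_simps)
        then show "1 + (2 * l + 1 - p) * (p - 1) + degree R < n - 1"
          using degR D by linarith
        show "n - 1 < p\<^sup>2 + (2 * l + 1 - p)"
          using * mi by (simp add: m t m' n_def D_def algebra_simps power2_eq_square)
      qed (use assms l m in auto)
      also have "(n - 1) mod p = i - 1"
      proof -
        have "n - 1 = (i - 1) + p * l" using mi by (simp add: n_def mult.commute)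
        then have "(n - 1) mod p = (i - 1) mod p" by (simp only: mod_mult_self2)
        then show ?thesis using assms mi by simp
      qed
      also have "degree ([:1, -1:] * R) \<le> 1 + (D - 1)"
        using degR by (intro order.trans[OF degree_mult_le]) simp
      then have "coeff ([:1, -1:] * R) (i - 1) = 0"
        using D by (intro coeff_eq_0) linarith
      finally show ?thesis unfolding R_def by simp
    qed
  qed
  show ?thesis
    using cong_trans[OF 1 cong_mult[OF cong_refl 2]] by (simp add: n_def)
qed

text \<open>Summing coefficients of (1 - x^p) f at multiples of \<open>p\<close> up to
  \<open>p * l\<close> recovers the coefficient of \<open>f\<close> at \<open>p * l\<close>. In the
  expansion, the term with index \<open>a\<close> occupies exponents from \<open>e a\<close> to
  \<open>e a + w\<close>, and \<open>T a\<close> collects its multiples of \<open>p\<close>: only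
  \<open>p\<close> for \<open>a = 0\<close>, only \<open>2 * p\<close> for \<open>a = 1\<close> (in
  range because \<open>2 \<le> l\<close>), and none up to \<open>p * l\<close> for larger
  \<open>a\<close>.\<close>

lemma coeff_geom_power_cong_small:
  assumes "prime p" "odd p" "2 \<le> l" "2 * l < p"
  shows "[coeff ([:1, -1:] * geom p ^ (2 * l)) (p * l) = -1] (mod int p)"
proof -
  have p: "p \<ge> 2" using \<open>prime p\<close> by (rule prime_ge_2_nat)
  define w where "w = p + 1 - 2 * l"
  define u :: "int poly" where "u = [:1, -1:] ^ w"
  define f where "f = [:1, -1:] * geom p ^ (2 * l)"
  have "even w" using assms by (simp add: w_def)
  have coeff_u: "coeff u j = (if j \<le> w then (-1) ^ j * int (w choose j) else 0)" for j
  proof -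
    have "u = (monom (-1) 1 + 1) ^ w"
      by (simp add: u_def monom_altdef one_pCons)
    also have "\<dots> = (\<Sum>k\<le>w. monom ((-1) ^ k * int (w choose k)) k)"
      unfolding binomial_ring
      by (intro sum.cong) (auto simp: monom_power of_nat_monom mult_monom)
    finally show ?thesis by (simp add: coeff_sum)
  qed
  have "w \<ge> 1" using assms by (simp add: w_def)
  then have "w choose (w - 1) = w" by (cases w) simp_all
  with \<open>w \<ge> 1\<close> \<open>even w\<close> have u: "coeff u w = 1" "coeff u (w - 1) = - int w"
    by (simp_all add: coeff_u)
  have u_0: "coeff u i = 0" if "i > w" for i
    using that by (simp add: coeff_u)
  define e where "e a = 2 * l - a + p * a" for a
  have e_0: "e 0 = 2 * l" and e_1: "e 1 = 2 * l - 1 + p"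
    by (simp_all add: e_def)
  define T where "T a = (\<Sum>s<Suc l. if e a \<le> p * s then coeff u (p * s - e a) else 0)" for a
  have T0: "T 0 = - int w"
  proof -
    have "T 0 = (\<Sum>s\<in>{1}. if e 0 \<le> p * s then coeff u (p * s - e 0) else 0)"
      unfolding T_def
    proof (rule sum.mono_neutral_right)
      show "\<forall>s\<in>{..<Suc l} - {1}. (if e 0 \<le> p * s then coeff u (p * s - e 0) else 0) = 0"
      proof
        fix s assume "s \<in> {..<Suc l} - {1}"
        then consider "s = 0" | "s \<ge> 2" by fastforce
        then show "(if e 0 \<le> p * s then coeff u (p * s - e 0) else 0) = 0"
        proof cases
          case 2
          have "p * 2 \<le> p * s" using 2 by (rule mult_le_mono2)
          then have "w < p * s - e 0" using assms unfolding e_0 w_def by linarith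
          then show ?thesis by (simp add: u_0)
        qed (use assms in \<open>simp add: e_def\<close>)
      qed
    qed (use assms in auto)
    also have "\<dots> = coeff u (w - 1)"
      using assms by (simp add: e_def w_def)
    finally show ?thesis using u(2) by simp
  qed
  have T1: "T 1 = 1"
  proof -
    have "T 1 = (\<Sum>s\<in>{2}. if e 1 \<le> p * s then coeff u (p * s - e 1) else 0)"
      unfolding T_def
    proof (rule sum.mono_neutral_right)
      show "\<forall>s\<in>{..<Suc l} - {2}. (if e 1 \<le> p * s then coeff u (p * s - e 1) else 0) = 0"
      proof
        fix s assume "s \<in> {..<Suc l} - {2}"
        then consider "s \<le> 1" | "s \<ge> 3" by fastforce
        then show "(if e 1 \<le> p * s then coeff u (p * s - e 1) else 0) = 0"
        proof cases
          case 1
          then have "p * s \<le> p * 1" by (intro mult_left_mono) auto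
          then have "\<not> e 1 \<le> p * s" using assms unfolding e_1 by linarith
          then show ?thesis by simp
        next
          case 2
          have "p * 3 \<le> p * s" using 2 by (rule mult_le_mono2)
          then have "w < p * s - e 1" using assms unfolding e_1 w_def by linarith
          then show ?thesis by (simp add: u_0)
        qed
      qed
    qed (use assms in auto)
    also have "\<dots> = coeff u w"
      using assms by (auto simp: e_def w_def intro!: arg_cong[of _ _ "coeff u"])
    finally show ?thesis by (simp add: u)
  qed
  have T2: "T a = 0" if "2 \<le> a" "a \<le> 2 * l" for a
    unfolding T_def
  proof (rule sum.neutral, rule ballI)
    fix s assume s: "s \<in> {..<Suc l}"
    show "(if e a \<le> p * s then coeff u (p * s - e a) else 0) = 0"
    proof (cases "s \<le> a")
      case True
      have "\<not> e a \<le> p * s"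
      proof
        assume "e a \<le> p * s"
        also have "p * s \<le> p * a" using True by simp
        \<comment> \<open>\<open>e a\<close> exceeds \<open>p * a\<close> except for
          \<open>a = 2 * l\<close>, where the multiple \<open>p * a\<close> lies beyond
          \<open>p * l\<close>.\<close>
        finally have "a = 2 * l" using that by (simp add: e_def)
        then have "p * Suc l \<le> p * a" using assms by (intro mult_le_mono2) simp
        moreover have "p * s \<le> p * l" using s by (intro mult_le_mono2) simp
        ultimately show False using \<open>e a \<le> p * s\<close> p unfolding e_def mult_Suc_right by linarith
      qed
      then show ?thesis by simp
    next
      case False
      then have "p * Suc a \<le> p * s" by (intro mult_le_mono2) simp
      then have "p * a + p \<le> p * s" by simp
      then have "w < p * s - e a" using that assms unfolding e_def w_def by linarith
      then show ?thesis by (simp add: u_0)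
    qed
  qed
  have "pcong (int p) ([:1, -1:] ^ p) (1 ^ p + monom (-1) 1 ^ p)"
    using pcong_power_prime_add[OF \<open>prime p\<close>, of 1 "monom (-1) 1"]
    by (simp add: monom_altdef one_pCons)
  also have "1 ^ p + monom (-1) 1 ^ p = - (monom 1 p - 1 :: int poly)"
    using \<open>odd p\<close> by (simp add: monom_power flip: minus_monom)
  finally have "pcong (int p) ([:1, -1:] ^ p * f) (- (monom 1 p - 1) * f)"
    by (intro pcong_mult pcong_refl)
  also have "[:1, -1:] ^ p * f = u * ([:1, -1:] * geom p) ^ (2 * l)"
  proof -
    have "p + 1 = w + 2 * l" using assms by (simp add: w_def)
    then have "[:1, -1:] ^ p * [:1, -1:] = u * [:1, -1 :: int:] ^ (2 * l)"
      unfolding u_def by (metis Suc_eq_plus1 power_Suc2 power_add)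
    then show ?thesis unfolding f_def by (simp only: power_mult_distrib flip: mult.assoc)
  qed
  also have "\<dots> = u * (monom (-1) p + monom 1 1) ^ (2 * l)"
    using p by (subst one_minus_x_times_geom) (auto simp flip: minus_monom)
  also have "\<dots> = (\<Sum>a\<le>2 * l. monom ((-1) ^ a * int (2 * l choose a)) (e a) * u)"
    unfolding binomial_ring sum_distrib_left
    by (intro sum.cong) (auto simp: monom_power of_nat_monom mult_monom e_def mult_ac add_ac)
  finally have cong: "pcong (int p) (\<Sum>a\<le>2 * l. monom ((-1) ^ a * int (2 * l choose a)) (e a) * u)
      (- (monom 1 p - 1) * f)" .
  have "coeff f (p * l) = - (\<Sum>s<Suc l. coeff ((monom 1 p - 1) * f) (0 + p * s))"
    using p by (subst sum_coeff_telescope) auto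
  also have "\<dots> = (\<Sum>s<Suc l. coeff (- (monom 1 p - 1) * f) (p * s))"
    by (simp only: mult_minus_left coeff_minus sum_negf add_0)
  also have "[\<dots> = (\<Sum>s<Suc l. coeff (\<Sum>a\<le>2 * l. monom ((-1) ^ a * int (2 * l choose a)) (e a) * u)
      (p * s))] (mod int p)"
    by (intro cong_sum pcong_coeff pcong_sym[OF cong])
  also have "(\<Sum>s<Suc l. coeff (\<Sum>a\<le>2 * l. monom ((-1) ^ a * int (2 * l choose a)) (e a) * u) (p * s))
      = (\<Sum>a\<le>2 * l. (-1) ^ a * int (2 * l choose a) * T a)"
    unfolding coeff_sum T_def sum_distrib_left
    by (subst sum.swap) (intro sum.cong, auto simp: coeff_monom_mult)
  also have "\<dots> = (\<Sum>a\<in>{0, 1}. (-1) ^ a * int (2 * l choose a) * T a)"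
    using assms by (intro sum.mono_neutral_right) (auto simp: T2)
  \<comment> \<open>The two terms are \<open>- w\<close> and \<open>- 2 * l\<close>, and
    \<open>w + 2 * l = p + 1\<close>.\<close>
  also have "\<dots> = - 1 - int p"
    using T0 T1 assms by (simp add: w_def of_nat_diff)
  also have "[- 1 - int p = -1] (mod int p)"
    by (simp add: cong_iff_dvd_diff)
  finally show ?thesis by (simp add: f_def)
qed

section \<open>Indices congruent to 1 modulo a prime\<close>

lemma v_prime_first_row:
  assumes "prime p" "odd p"
  shows "[v (l * p + 1) = coeff ([:1, -1:] * geom p ^ (2 * l)) (p * l)] (mod int p)"
  using v_prime_cong_coeff[OF assms(1), of "l * p + 1" "2 * l" 0 "-1"]
  by (simp add: cong_iff_dvd_diff linear_factors_def mult.commute)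

text \<open>For odd \<open>p\<close> the polynomial is (x - x^p) \<open>geom p\<close>, whose
  coefficient at \<open>p\<close> is that of \<open>geom p\<close> at \<open>p - 1\<close>. The
  prime 2 is settled by parity.\<close>

lemma v_prime_Suc:
  assumes "prime p"
  shows "[v (p + 1) = 1] (mod int p)"
proof (cases "odd p")
  case True
  have p: "p \<ge> 2" using assms by (rule prime_ge_2_nat)
  have "[:1, -1:] * geom p ^ 2 = (monom 1 1 - monom 1 p) * geom p"
    using one_minus_x_times_geom[of p] p by (simp only: power2_eq_square flip: mult.assoc)
  also have "coeff \<dots> p = 1"
    using p by (simp add: left_diff_distrib coeff_monom_mult coeff_geom)
  finally have "coeff ([:1, -1:] * geom p ^ 2) p = 1" .
  then show ?thesis using v_prime_first_row[OF assms True, of 1] by simp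
next
  case False
  then have "p = 2" using assms primes_dvd_imp_eq two_is_prime_nat by blast
  then show ?thesis using odd_v[of 3] by (simp add: cong_iff_dvd_diff)
qed

text \<open>For \<open>2 * l > p\<close> the reduction applies with \<open>R = 1\<close>: the
  constant term of 1 - x is 1, and the sign is -1 because \<open>2 * l - p\<close> is odd.\<close>

lemma v_prime_first_row_minus_1:
  assumes "prime p" "2 \<le> l" "l \<le> p + 1"
  shows "[v (l * p + 1) = -1] (mod int p)"
proof (cases "odd p")
  case True
  then obtain m where m: "p = 2 * m + 1" by (elim oddE)
  have p: "p > 2" using assms True prime_gt_1_nat[of p] by (cases "p = 2") auto
  then obtain m' where m': "m = Suc m'" using m by (cases m) auto
  note v_prime_first_row[OF assms(1) True, of l]
  also have "[coeff ([:1, -1:] * geom p ^ (2 * l)) (p * l) = -1] (mod int p)"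
  proof (cases "2 * l < p")
    case False
    then have "m + 1 \<le> l" by (simp add: m)
    then obtain t where t: "l = m + 1 + t" using le_Suc_ex by blast
    \<comment> \<open>Both bounds on the index \<open>p * l\<close> follow from this form of
      \<open>l \<le> p + 1\<close>.\<close>
    have "l * (p - 2) \<le> (p + 1) * (p - 2)"
      using assms by (intro mult_right_mono) auto
    then have *: "l * (2 * m - 1) \<le> (2 * m + 2) * (2 * m - 1)"
      by (simp add: m)
    have "[coeff ([:1, -1:] * geom p ^ (2 * l) * 1) (p * l)
        = (-1) ^ (2 * l - p) * coeff ([:1, -1:] * 1) (p * l mod p)] (mod int p)"
    proof (rule coeff_geom_power_cong)
      show "1 + (2 * l - p) * (p - 1) + degree (1 :: int poly) < p * l"
        using * by (simp add: m t m' algebra_simps)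
      show "p * l < p\<^sup>2 + (2 * l - p)"
        using * by (simp add: m t m' algebra_simps power2_eq_square)
    qed (use assms p False in auto)
    moreover have "odd (2 * l - p)" using True False by simp
    ultimately show ?thesis by simp
  qed (rule coeff_geom_power_cong_small, use assms True in auto)
  finally show ?thesis .
next
  case False
  then have "p = 2" using assms primes_dvd_imp_eq two_is_prime_nat by blast
  then show ?thesis using odd_v[of "l * p + 1"] by (simp add: cong_iff_dvd_diff)
qed

subsection \<open>Powers of two\<close>

text \<open>The difference is K y (f + g) + K^2 y^2; here f + g is even by the congruence, and K^2
  is a multiple of 2 K.\<close>

lemma pcong_shift_pair:
  fixes f g :: "int poly"
  assumes "pcong 2 f g" "even K"
  shows "pcong (2 * K) ((f + smult K y) * (g + smult K y)) (f * g)"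
proof -
  obtain h where h: "f = g + smult 2 h"
    using assms(1) by (auto simp: pcong_def algebra_simps elim!: dvdE)
  obtain M where M: "K = 2 * M" using assms(2) by (elim evenE)
  have "(f + smult K y) * (g + smult K y) - f * g = smult (2 * K) (y * (g + h) + smult M (y * y))"
    by (rule poly_eqI) (simp add: h M numeral_poly algebra_simps)
  then show ?thesis
    by (simp add: pcong_def const_poly_dvd_iff)
qed

text \<open>Pairing \<open>j\<close> with \<open>j + 2\<close> puts together factors that are
  congruent modulo 2, as \<open>pcong_shift_pair\<close> demands.\<close>

lemma prod_lessThan_quadruple:
  fixes f :: "nat \<Rightarrow> 'a :: comm_monoid_mult"
  shows "(\<Prod>j<4 * Suc N. f j) = (\<Prod>j<4 * N. f j) * ((f (4 * N) * f (4 * N + 2)) *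
      (f (4 * N + 1) * f (4 * N + 3)))"
proof -
  have "4 * Suc N = Suc (Suc (Suc (Suc (4 * N))))" by simp
  then have "(\<Prod>j<4 * Suc N. f j) = (\<Prod>j<4 * N. f j) * f (4 * N) * f (4 * N + 1) * f (4 * N + 2)
      * f (4 * N + 3)"
    by (simp only: prod.lessThan_Suc) (simp add: numeral_2_eq_2 numeral_3_eq_3)
  then show ?thesis by (simp add: mult_ac)
qed

lemma linear_factors_shift:
  assumes "even K"
  shows "pcong (2 * int K) (\<Prod>j<4 * N. [:d - int (K + j), int (K + j):]) (linear_factors d (4 * N))"
proof (induction N)
  case (Suc N)
  let ?f = "\<lambda>j. [:d - int j, int j:]"
  have shift: "?f (K + j) = ?f j + smult (int K) [:-1, 1:]" for j
    by simp
  have pair: "pcong (2 * int K) (?f (K + i) * ?f (K + j)) (?f i * ?f j)" if "j = i + 2" for i j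
    unfolding shift using assms that
    by (intro pcong_shift_pair) (auto simp: cong_iff_dvd_diff intro!: pcong_linear)
  have "pcong (2 * int K) (\<Prod>j<4 * Suc N. ?f (K + j)) (\<Prod>j<4 * Suc N. ?f j)"
    unfolding prod_lessThan_quadruple
    by (intro pcong_mult pair Suc.IH[unfolded linear_factors_def]) simp_all
  then show ?case by (simp add: linear_factors_def)
qed (simp add: linear_factors_def)

text \<open>The second half of the range is the first half shifted by \<open>2 ^ q\<close>;
  \<open>q \<ge> 2\<close> lets it split into blocks of four.\<close>

lemma linear_factors_double:
  assumes "q \<ge> 2"
  shows "pcong (2 ^ Suc q) (linear_factors d (2 ^ Suc q)) (linear_factors d (2 ^ q) ^ 2)"
proof -
  obtain t where t: "q = Suc (Suc t)" using assms by (metis add_2_eq_Suc le_Suc_ex)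
  have 4: "2 ^ q = 4 * (2 :: nat) ^ t" by (simp add: t)
  have "linear_factors d (2 ^ Suc q) = linear_factors d (2 ^ q) *
      (\<Prod>j<2 ^ q. [:d - int (2 ^ q + j), int (2 ^ q + j):])"
    using linear_factors_add[of d "2 ^ q" "2 ^ q"] by (simp add: mult_2)
  also have "pcong (2 * int (2 ^ q)) \<dots> (linear_factors d (2 ^ q) * linear_factors d (2 ^ q))"
    unfolding 4 by (intro pcong_mult pcong_refl linear_factors_shift) simp
  finally show ?thesis by (simp add: power2_eq_square)
qed

lemma square_add_smult:
  fixes f g :: "int poly"
  shows "(f + smult c g) ^ 2 = f * f + smult (2 * c) (f * g) + smult (c * c) (g * g)"
  unfolding power2_sum by (simp add: power2_eq_square numeral_poly mult_ac)

text \<open>Squaring gains one power of 2: the cross term carries \<open>2 ^ Suc q\<close>, and the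
  last one \<open>2 ^ (2 * q)\<close> with \<open>2 * q \<ge> Suc q\<close>.\<close>

lemma pcong_square_lift:
  assumes "pcong (2 ^ q) f g" "q \<ge> 1"
  shows "pcong (2 ^ Suc q) (f ^ 2) (g ^ 2)"
proof -
  obtain t where t: "q = Suc t" using assms(2) by (cases q) auto
  obtain h where "f - g = [:2 ^ q:] * h"
    using assms(1) by (auto simp: pcong_def elim!: dvdE)
  then have h: "f = g + smult (2 ^ q) h" by (simp add: algebra_simps)
  have "f ^ 2 - g ^ 2 = smult (2 ^ Suc q) (g * h + smult (2 ^ t) (h * h))"
    by (rule poly_eqI) (simp add: h t power2_eq_square numeral_poly algebra_simps)
  then show ?thesis by (simp add: pcong_def const_poly_dvd_iff)
qed

section \<open>The product of \<open>2 ^ q\<close> factors in explicit form\<close>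

lemma linear_factors_4:
  assumes "odd d"
  shows "pcong 4 (linear_factors d 4) [:0, 2, 1, 2:]"
proof -
  have "d mod 4 = 1 \<or> d mod 4 = 3"
    using assms by presburger
  then obtain c where c: "c = 1 \<or> c = 3" "[d = c] (mod 4)"
    by (auto simp: cong_def)
  have "pcong 4 (linear_factors d 4) (linear_factors c 4)"
    by (rule linear_factors_cong) fact
  also have "pcong 4 (linear_factors c 4) [:0, 2, 1, 2:]"
    using c(1)
    by (auto simp: linear_factors_def numeral_eq_Suc pcong_iff_coeff coeff_pCons cong_def
        split: nat.splits)
  finally show ?thesis .
qed

text \<open>Squaring the form modulo 4 produces \<open>[:1, 1, 0, 1, 1:]\<close> modulo 8. From
  there on it reproduces itself: with h = \<open>2 ^ (q + 2)\<close>, the square of the error term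
  carries h^2, a multiple of the new modulus 4 h because h is at least 4.\<close>

lemma linear_factors_two_power:
  assumes "odd d"
  shows "pcong (2 ^ (q + 3)) (linear_factors d (2 ^ (q + 3)))
    (monom 1 (2 ^ (q + 2)) + smult (2 ^ (q + 2)) (monom 1 (2 ^ (q + 2) - 2) * [:1, 1, 0, 1, 1:]))"
proof (induction q)
  case 0
  have "pcong (2 ^ Suc 2) (linear_factors d (2 ^ Suc 2)) (linear_factors d (2 ^ 2) ^ 2)"
    by (rule linear_factors_double) simp
  also have "pcong (2 ^ Suc 2) \<dots> ([:0, 2, 1, 2:] ^ 2)"
    using linear_factors_4[OF assms] by (intro pcong_square_lift) auto
  also have "pcong (2 ^ Suc 2) \<dots> [:0, 0, 4, 4, 1, 4, 4:]"
    by (simp add: power2_eq_square pcong_iff_coeff coeff_pCons cong_def split: nat.splits)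
  also have "[:0, 0, 4, 4, 1, 4, 4:] =
    monom 1 (2 ^ (0 + 2)) + smult (2 ^ (0 + 2)) (monom 1 (2 ^ (0 + 2) - 2)
        * [:1, 1, 0, 1, 1 :: int:])"
    by (simp add: monom_altdef numeral_eq_Suc)
  finally show ?case by simp
next
  case (Suc q)
  let ?h = "2 ^ (q + 2) :: nat"
  let ?F = "monom 1 (?h - 2) * [:1, 1, 0, 1, 1 :: int:]"
  have "pcong (2 ^ Suc (q + 3)) (linear_factors d (2 ^ Suc (q + 3)))
      (linear_factors d (2 ^ (q + 3)) ^ 2)"
    by (rule linear_factors_double) simp
  also have "pcong (2 ^ Suc (q + 3)) \<dots> ((monom 1 ?h + smult (2 ^ (q + 2)) ?F) ^ 2)"
    by (intro pcong_square_lift Suc.IH) simp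
  also have "pcong (2 ^ Suc (q + 3)) \<dots> (monom 1 (2 * ?h) + smult (2 ^ (q + 3)) (monom 1 ?h * ?F))"
  proof -
    have "(monom 1 ?h + smult (2 ^ (q + 2)) ?F) ^ 2
        - (monom 1 (2 * ?h) + smult (2 ^ (q + 3)) (monom 1 ?h * ?F))
        = smult (2 ^ (q + 2) * 2 ^ (q + 2)) (?F * ?F)"
      unfolding square_add_smult by (simp add: mult_monom power_add flip: mult_2)
          (simp add: mult.commute)
    also have "[:2 ^ Suc (q + 3):] dvd \<dots>"
      by (simp add: const_poly_dvd_iff power_add)
    finally show ?thesis by (simp only: pcong_def)
  qed
  also have "monom 1 ?h * ?F = monom 1 (2 * ?h - 2) * [:1, 1, 0, 1, 1 :: int:]"
  proof -
    have "?h + (?h - 2) = 2 * ?h - 2" by simp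
    then show ?thesis by (simp only: mult_monom mult_1 flip: mult.assoc)
  qed
  also have "2 * ?h = 2 ^ (q + 3)" by (simp add: power_add)
  finally show ?case
    by (simp only: add_Suc) (simp only: add_Suc_right[symmetric] eval_nat_numeral)
qed

text \<open>Modulus 4 has a different \<open>G\<close> from the higher powers; the parity of one
  coefficient is all that both cases must share.\<close>

lemma linear_factors_two_power':
  assumes "odd d" "q \<ge> 2"
  obtains G where "odd (coeff ([:1, -1:] * G) 2)"
    and "pcong (2 ^ q) (linear_factors d (2 ^ q))
      (monom 1 (2 ^ (q - 1)) + smult (2 ^ (q - 1)) (monom 1 (2 ^ (q - 1) - 2) * G))"
proof (cases "q = 2")
  case True
  show ?thesis
    by (rule that[of "[:0, 1, 0, 1:]"])
       (use linear_factors_4[OF assms(1)] in \<open>simp_all add: True monom_altdef numeral_eq_Suc\<close>)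
next
  case False
  then have "q - 3 + 3 = q" "q - 3 + 2 = q - 1" using assms by auto
  then show ?thesis
    using that[of "[:1, 1, 0, 1, 1:]"] linear_factors_two_power[OF assms(1), of "q - 3"]
    by (simp add: numeral_2_eq_2)
qed

text \<open>Raising \<open>n\<close> by \<open>h\<close> keeps \<open>d\<close> modulo
  \<open>2 * h\<close> and adds one full period. Its leading term shifts the index by
  \<open>h\<close> and returns \<open>v n\<close>; its error term gives \<open>h\<close> times a
  coefficient that is odd, since \<open>R\<close> is x^(n-1) modulo 2.\<close>

lemma v_add_half_period:
  assumes "q \<ge> 2" "n \<ge> 1"
  shows "[v (n + 2 ^ (q - 1)) = v n + 2 ^ (q - 1)] (mod 2 ^ q)"
proof -
  define h :: nat where "h = 2 ^ (q - 1)"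
  obtain t where t: "q = Suc (Suc t)" using assms(1) by (metis add_2_eq_Suc le_Suc_ex)
  have q: "2 ^ q = 2 * h" and h: "h \<ge> 2" and q_int: "2 ^ q = 2 * int h"
    by (simp_all add: h_def t)
  define d where "d = 2 * int n - 3"
  define R where "R = linear_factors d (2 * n - 2)"
  have "odd d" by (simp add: d_def)
  then obtain G where G: "odd (coeff ([:1, -1:] * G) 2)"
    "pcong (2 ^ q) (linear_factors d (2 ^ q)) (monom 1 h + smult (int h) (monom 1 (h - 2) * G))"
    using linear_factors_two_power'[of d q] assms(1) unfolding h_def by auto
  have "[v (n + h) = coeff ([:1, -1:] * (linear_factors d (2 ^ q) ^ 1 * R)) (n + h - 1)]
      (mod int (2 ^ q))"
    unfolding R_def
  proof (rule v_cong_coeff)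
    show "2 * (n + h) - 2 = 2 ^ q * 1 + (2 * n - 2)"
      using assms(2) q by simp
    show "[2 * int (n + h) - 3 = d] (mod int (2 ^ q))"
      using q by (simp add: d_def cong_iff_dvd_diff)
  qed (use assms in simp)
  then have "[v (n + h) = coeff ([:1, -1:] * (linear_factors d (2 ^ q) * R)) (n + h - 1)]
      (mod 2 ^ q)"
    by simp
  also have "[coeff ([:1, -1:] * (linear_factors d (2 ^ q) * R)) (n + h - 1) =
      coeff ([:1, -1:] * ((monom 1 h + smult (int h) (monom 1 (h - 2) * G)) * R)) (n + h - 1)]
          (mod 2 ^ q)"
    by (intro pcong_coeff pcong_mult pcong_refl G)
  also have "[:1, -1:] * ((monom 1 h + smult (int h) (monom 1 (h - 2) * G)) * R) =
      monom 1 h * ([:1, -1:] * R) + smult (int h) (monom 1 (h - 2) * ([:1, -1:] * G * R))"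
    by (simp only: distrib_left distrib_right mult_smult_left mult_smult_right mult_ac)
  also have "coeff \<dots> (n + h - 1) = v n + int h * coeff ([:1, -1:] * G * R) (n + 1)"
  proof -
    have "n + h - 1 - h = n - 1" "n + h - 1 - (h - 2) = n + 1"
      using assms(2) h by auto
    then show ?thesis
      using assms(2) h by (simp only: coeff_add coeff_smult coeff_monom_mult)
          (auto simp: v_eq_coeff R_def d_def)
  qed
  also have "[v n + int h * coeff ([:1, -1:] * G * R) (n + 1) = v n + int h] (mod 2 ^ q)"
  proof -
    have "pcong 2 ([:1, -1:] * G * R) ([:1, -1:] * G * monom 1 (n - 1))"
      using linear_factors_cong_2[of d "n - 1"] \<open>odd d\<close>
      by (intro pcong_mult pcong_refl) (simp add: R_def right_diff_distrib')
    then have "[coeff ([:1, -1:] * G * R) (n + 1)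
        = coeff ([:1, -1:] * G * monom 1 (n - 1)) (n + 1)] (mod 2)"
      by (rule pcong_coeff)
    also have "coeff ([:1, -1:] * G * monom 1 (n - 1)) (n + 1) = coeff ([:1, -1:] * G) 2"
      using assms(2) unfolding mult.commute[of _ "monom 1 (n - 1)"] coeff_monom_mult by simp
    finally have "odd (coeff ([:1, -1:] * G * R) (n + 1))"
      using G(1) by (metis cong_dvd_iff)
    then obtain m where "coeff ([:1, -1:] * G * R) (n + 1) = 2 * m + 1" by (elim oddE)
    then show ?thesis
      unfolding q_int by (simp add: cong_iff_dvd_diff algebra_simps)
  qed
  finally show ?thesis by (simp add: h_def)
qed

text \<open>The period \<open>2 ^ q\<close> is the half period for the modulus
  \<open>2 ^ Suc q\<close>, whose increment \<open>2 ^ q\<close> vanishes modulo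
  \<open>2 ^ q\<close>.\<close>

lemma v_two_power_period:
  assumes "q \<ge> 1" "n \<ge> 1"
  shows "[v (l * 2 ^ q + n) = v n] (mod 2 ^ q)"
proof (induction l)
  case (Suc l)
  have "[v ((l * 2 ^ q + n) + 2 ^ (Suc q - 1))
      = v (l * 2 ^ q + n) + 2 ^ (Suc q - 1)] (mod 2 ^ Suc q)"
    using assms by (intro v_add_half_period) auto
  moreover have "(l * 2 ^ q + n) + 2 ^ (Suc q - 1) = Suc l * 2 ^ q + n" by simp
  ultimately have "[v (Suc l * 2 ^ q + n) = v (l * 2 ^ q + n) + 2 ^ (Suc q - 1)] (mod 2 ^ Suc q)"
    by (simp only:)
  then have "[v (Suc l * 2 ^ q + n) = v (l * 2 ^ q + n) + 2 ^ q] (mod 2 ^ q)"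
    unfolding diff_Suc_1 by (rule cong_dvd_modulus) simp
  also have "[v (l * 2 ^ q + n) + 2 ^ q = v (l * 2 ^ q + n) + 0] (mod 2 ^ q)"
    by (intro cong_add cong_refl) (simp add: cong_0_iff)
  finally show ?case using Suc by (simp add: cong_trans)
qed simp

text \<open>A solution \<open>i\<close> modulo \<open>2 ^ q\<close> lifts uniquely:
  \<open>v i\<close> and \<open>v (i + 2 ^ q)\<close> differ by \<open>2 ^ q\<close> modulo
  \<open>2 ^ Suc q\<close>, so exactly one of them hits \<open>a\<close>. Thus \<open>red\<close> is
  a bijection between the solution sets.\<close>

lemma card_odd_residue:
  fixes a :: int
  assumes "q \<ge> 1" "odd a"
  shows "card {i \<in> {1..2 ^ q}. [v i = a] (mod 2 ^ q)} = 2"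
  using assms(1)
proof (induction q rule: dec_induct)
  case base
  have "{i \<in> {1..2 ^ 1}. [v i = a] (mod 2 ^ 1)} = {1, 2}"
    using assms(2) odd_v by (auto simp: cong_iff_dvd_diff)
  then show ?case by simp
next
  case (step q)
  define A where "A = {i \<in> {1..2 ^ q}. [v i = a] (mod 2 ^ q)}"
  define B where "B = {i \<in> {1..2 ^ Suc q}. [v i = a] (mod 2 ^ Suc q)}"
  define red where "red i = (if i \<le> 2 ^ q then i else i - 2 ^ q)" for i :: nat
  have half: "[v (i + 2 ^ q) = v i + 2 ^ q] (mod 2 ^ Suc q)" if "i \<ge> 1" for i
    using v_add_half_period[of "Suc q" i] step.hyps that by simp
  have not_both: False if "[x = a] (mod 2 ^ Suc q)" "[x + 2 ^ q = a] (mod 2 ^ Suc q)" for x :: int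
  proof -
    have "[x + 2 ^ q = x + 0] (mod 2 ^ Suc q)"
      using cong_trans[OF that(2) cong_sym[OF that(1)]] by simp
    then have "(2 :: int) ^ Suc q dvd 2 ^ q"
      unfolding cong_add_lcancel by (simp add: cong_0_iff)
    then show False by simp
  qed
  have one: "[x = a] (mod 2 ^ Suc q) \<or> [x + 2 ^ q = a] (mod 2 ^ Suc q)"
    if "[x = a] (mod 2 ^ q)" for x :: int
  proof -
    obtain m where m: "x - a = 2 ^ q * m"
      using \<open>[x = a] (mod 2 ^ q)\<close> by (auto simp: cong_iff_dvd_diff)
    show ?thesis
    proof (cases "even m")
      case True
      then show ?thesis using m by (auto simp: cong_iff_dvd_diff)
    next
      case False
      then have "x + 2 ^ q - a = 2 ^ q * (m + 1)" "even (m + 1)"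
        using m by (auto simp: algebra_simps)
      then show ?thesis by (auto simp: cong_iff_dvd_diff elim!: evenE)
    qed
  qed
  have "bij_betw red B A"
  proof (rule bij_betw_imageI)
    show "inj_on red B"
    proof (rule inj_onI)
      have *: False if "i \<in> B" "i + 2 ^ q \<in> B" for i
        using that not_both[of "v i"] half[of i] cong_trans[OF cong_sym[OF half[of i]]]
        by (auto simp: B_def)
      fix i j assume ij: "i \<in> B" "j \<in> B" "red i = red j"
      show "i = j"
      proof (rule ccontr)
        assume "i \<noteq> j"
        then have "j = i + 2 ^ q \<or> i = j + 2 ^ q"
          using ij(3) by (auto simp: red_def split: if_splits)
        then show False using ij * by blast
      qed
    qed
    show "red ` B = A"
    proof (intro equalityI subsetI)
      fix j assume "j \<in> red ` B"
      then obtain i where i: "i \<in> B" "j = red i" by blast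
      have "[v i = a] (mod 2 ^ q)"
        using i(1) by (auto simp: B_def intro: cong_dvd_modulus)
      moreover have "[v i = v j] (mod 2 ^ q)"
        using v_two_power_period[of q j 1] step.hyps i
        by (auto simp: red_def B_def)
      ultimately show "j \<in> A"
        using i cong_trans[OF cong_sym] by (auto simp: A_def B_def red_def)
    next
      fix i assume i: "i \<in> A"
      from one[of "v i"] i have "i \<in> B \<or> i + 2 ^ q \<in> B"
        using cong_trans[OF half[of i]] by (auto simp: A_def B_def)
      moreover have "red i = i" "red (i + 2 ^ q) = i"
        using i by (auto simp: A_def red_def)
      ultimately show "i \<in> red ` B" by (metis imageI)
    qed
  qed
  then show ?case
    using step.IH by (simp add: bij_betw_same_card A_def B_def)
qed

text \<open>
  With \<open>R = L (-3) (2k - 2)\<close> and \<open>k = 2\<^sup>q\<close>, the full period gives \<open>R (1 + 2x) (2 + x) \<equiv> x\<^sup>k\<close>, and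
  \<open>(1 - x) / ((1 + 2x) (2 + x)) = 1 / (1 + 2x) - 1 / (2 + x)\<close>.
\<close>
lemma v_two_power:
  assumes "q \<ge> 2"
  shows "[v (2 ^ q) = -1] (mod 2 ^ q)"
proof -
  define k :: nat where "k = 2 ^ q"
  have k: "k > q" "k \<ge> 4"
    unfolding k_def using power_increasing[OF assms, of "2 :: nat"] by simp_all
  have k_int: "int k = 2 ^ q" by (simp add: k_def)
  define R where "R = linear_factors (-3) (2 * k - 2)"
  define f :: "int poly" where "f = [:1, -1:] * R"
  let ?X = "monom 1 k :: int poly"
  have v: "[v k = coeff f (k - 1)] (mod int k)"
    unfolding f_def R_def
    using v_cong_coeff[of k k 0 "2 * k - 2" "-3"] k by (simp add: cong_iff_dvd_diff)
  define h :: nat where "h = 2 ^ (q - 1)"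
  obtain t where t: "q = Suc (Suc t)" using assms by (metis add_2_eq_Suc le_Suc_ex)
  have h: "k = 2 * h" "k dvd h * h"
    by (simp_all add: h_def k_def t)
  have h_dvd: "int k dvd int h * int h"
    using h(2) by (simp only: of_nat_dvd_iff flip: of_nat_mult)
  have full: "pcong (int k) (R * ([:1, 2:] * [:2, 1:])) ?X"
  proof -
    \<comment> \<open>These are the two factors missing from two full periods: the indices
      \<open>2 * k - 2\<close> and \<open>2 * k - 1\<close> are -2 and -1 modulo \<open>k\<close>,
      and the two minus signs cancel.\<close>
    have "[:1, 2:] * [:2, 1:] = [:-3 - (-2), -2:] * [:-3 - (-1), -1 :: int:]"
      by simp
    also have "pcong (int k) (R * \<dots>) (R * ([:-3 - int (2 * k - 2), int (2 * k - 2):]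
        * [:-3 - int (2 * k - 1), int (2 * k - 1):]))"
      using k by (intro pcong_mult pcong_refl pcong_linear)
          (auto simp: cong_iff_dvd_diff of_nat_diff)
    also have "\<dots> = linear_factors (-3) (k * 2 + 0)"
    proof -
      have "k * 2 + 0 = Suc (Suc (2 * k - 2))" and 1: "Suc (2 * k - 2) = 2 * k - 1"
        using k by simp_all
      then have "linear_factors (-3) (k * 2 + 0) = linear_factors (-3) (Suc (Suc (2 * k - 2)))"
        by (simp only:)
      then show ?thesis
        unfolding R_def linear_factors_def prod.lessThan_Suc mult.assoc unfolding 1 by (rule sym)
    qed
    also have "pcong (int k) \<dots> (linear_factors (-3) k ^ 2 * linear_factors (-3) 0)"
      by (rule linear_factors_period)
    also have "\<dots> = linear_factors (-3) k ^ 2"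
      by (simp add: linear_factors_def)
    also have "pcong (int k) \<dots> ?X"
    proof -
      obtain G where "pcong (int k) (linear_factors (-3) k) (monom 1 h + smult (int h) G)"
        using linear_factors_two_power'[of "-3" q] assms unfolding h_def k_def by auto
      then have "pcong (int k) (linear_factors (-3) k ^ 2) ((monom 1 h + smult (int h) G) ^ 2)"
        by (rule pcong_power)
      also have "pcong (int k) \<dots> ?X"
        unfolding square_add_smult using h_dvd
        by (auto simp: mult_monom pcong_def const_poly_dvd_iff h(1) simp flip: mult_2
            intro!: dvd_add)
      finally show ?thesis .
    qed
    finally show ?thesis .
  qed
  \<comment> \<open>Since \<open>k\<close> divides \<open>(-2) ^ k\<close>, \<open>U\<close> inverts
    1 + 2x modulo \<open>k\<close>, whereas 2 + x is only inverted up to x^k, by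
    \<open>W\<close>.\<close>
  define U :: "int poly" where "U = (\<Sum>i<k. monom (-2) 1 ^ i)"
  define W :: "int poly" where "W = (\<Sum>i<k. [:-2:] ^ (k - Suc i) * monom 1 1 ^ i)"
  have k_dvd: "int k dvd (-2) ^ k"
    unfolding k_int power_minus[of 2] using k by (intro dvd_mult le_imp_power_dvd) simp
  have U: "pcong (int k) ([:1, 2:] * U) 1"
  proof -
    have "1 - monom (-2) 1 = [:1, 2 :: int:]"
      by (simp add: monom_altdef one_pCons)
    then have "[:1, 2:] * U = 1 - monom (-2) 1 ^ k"
      unfolding U_def one_diff_power_eq[of _ k] by simp
    also have "\<dots> = 1 - monom ((-2) ^ k) k"
      by (simp add: monom_power)
    finally have "[:1, 2:] * U = 1 - monom ((-2) ^ k) k" .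
    then show ?thesis
      using k_dvd by (simp add: pcong_def const_poly_dvd_iff)
  qed
  have W: "pcong (int k) ([:2, 1:] * W) ?X"
  proof -
    have "monom 1 1 - [:-2:] = [:2, 1 :: int:]"
      by (simp add: monom_altdef)
    then have "[:2, 1:] * W = monom 1 1 ^ k - [:-2:] ^ k"
      unfolding W_def power_diff_sumr2[of _ k] by simp
    also have "\<dots> = monom 1 k - monom ((-2) ^ k) 0"
      by (simp add: monom_power monom_0 poly_const_pow)
    finally have "[:2, 1:] * W = monom 1 k - monom ((-2) ^ k) 0" .
    then show ?thesis
      using k_dvd by (simp add: pcong_def const_poly_dvd_iff)
  qed
  \<comment> \<open>Multiplication by x^k merely shifts coefficients, and it brings in both linear
    factors, which then complete \<open>R\<close>.\<close>
  have "pcong (int k) (?X * f) (([:1, 2:] * U) * ([:2, 1:] * W) * f)"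
    using pcong_mult[OF pcong_mult[OF U W] pcong_refl[of _ f]] by (simp add: pcong_sym)
  also have "([:1, 2:] * U) * ([:2, 1:] * W) * f
      = (R * ([:1, 2:] * [:2, 1:])) * ([:1, -1:] * U * W)"
    unfolding f_def by (simp only: mult_ac)
  also have "pcong (int k) \<dots> (?X * ([:1, -1:] * U * W))"
    by (intro pcong_mult pcong_refl full)
  also have "[:1, -1:] * U * W = ([:2, 1:] * W) * U + (- 1) * (([:1, 2:] * U) * W)"
  proof -
    have "[:1, -1:] = [:2, 1:] - [:1, 2 :: int:]" by simp
    then show ?thesis by (simp only: left_diff_distrib)
        (simp only: mult_ac mult_minus1 uminus_add_conv_diff diff_conv_add_uminus mult_minus_left)
  qed
  also have "pcong (int k) (?X * \<dots>) (?X * (?X * U + (-1) * (1 * W)))"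
    by (intro pcong_mult pcong_add pcong_refl U W)
  finally have "[coeff (?X * f) (k + (k - 1))
      = coeff (?X * (?X * U + (-1) * (1 * W))) (k + (k - 1))] (mod int k)"
    by (rule pcong_coeff)
  then have "[coeff f (k - 1) = coeff (?X * U + (-1) * (1 * W)) (k - 1)] (mod int k)"
    by (simp only: coeff_monom_mult diff_add_inverse not_add_less1 if_False mult_1)
  then have "[coeff f (k - 1) = - coeff W (k - 1)] (mod int k)"
    using k by (simp add: coeff_monom_mult)
  also have "coeff W (k - 1) = 1"
  proof -
    have "coeff W (k - 1) = (\<Sum>i<k. if i = k - 1 then 1 else 0)"
      unfolding W_def coeff_sum
      by (intro sum.cong) (auto simp: monom_power poly_const_pow)
    then show ?thesis using k by simp
  qed
  finally have "[v k = -1] (mod int k)" using cong_trans[OF v] by simp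
  then show ?thesis by (simp add: k_def)
qed

section \<open>Initial values and assembly of the ten statements\<close>

lemma v_1: "v 1 = 1" and v_2: "v 2 = 1"
  by (simp_all add: v_def numeral_2_eq_2)

theorem theorem1:
  shows
    "(\<forall>n::nat. n \<ge> 1 \<longrightarrow> odd (v n)) \<and>
     (\<forall>(k::nat) (l::nat). k \<ge> 1 \<longrightarrow> [v (l * k + 1) = v (l * k + 2)] (mod int k)) \<and>
     (\<forall>(k::nat) (l::nat). even k \<and> k \<ge> 2 \<longrightarrow>
        [v (l * k + k div 2 + 1) = v (l * k + k div 2 + 2)] (mod int k)) \<and>
     (\<forall>(k::nat) (l::nat). odd k \<and> k \<ge> 3 \<longrightarrow>
        [v (l * k + (k + 3) div 2) = 0] (mod int k)) \<and>
     (\<forall>k::nat. prime k \<longrightarrow>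
        [v 1 = 1] (mod int k) \<and> [v 2 = 1] (mod int k) \<and>
        [v (k + 1) = 1] (mod int k) \<and> [v (k + 2) = 1] (mod int k) \<and>
        (\<forall>l::nat. 2 \<le> l \<and> l \<le> k + 1 \<longrightarrow>
           [v (l * k + 1) = -1] (mod int k) \<and> [v (l * k + 2) = -1] (mod int k))) \<and>
     (\<forall>k::nat. prime k \<and> k > 2 \<longrightarrow>
        (\<forall>i::nat. (k + 3) div 2 \<le> i \<and> i \<le> k \<longrightarrow> [v i = 0] (mod int k))) \<and>
     (\<forall>k::nat. prime k \<and> k > 2 \<longrightarrow>
        (\<forall>(l::nat) (i::nat). (k - 1) div 2 \<le> l \<and> l \<le> k \<and> (k + 3) div 2 \<le> i \<and> i \<le> k \<longrightarrow>
           [v (l * k + i) = 0] (mod int k))) \<and>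
     (\<forall>q::nat. q \<ge> 1 \<longrightarrow>
        (\<forall>(l::nat) (i::nat). 1 \<le> i \<and> i \<le> 2 ^ q \<longrightarrow>
           [v (l * 2 ^ q + i) = v i] (mod 2 ^ q)) \<and>
        (\<forall>a::int. odd a \<longrightarrow> card {i \<in> {1..2 ^ q}. [v i = a] (mod 2 ^ q)} = 2)) \<and>
     (\<forall>q::nat. q \<ge> 2 \<longrightarrow>
        [v 1 = 1] (mod 2 ^ q) \<and> [v 2 = 1] (mod 2 ^ q) \<and>
        [v (2 ^ (q - 1)) = 2 ^ (q - 1) - 1] (mod 2 ^ q) \<and>
        [v (2 ^ (q - 1) + 1) = 2 ^ (q - 1) + 1] (mod 2 ^ q) \<and>
        [v (2 ^ (q - 1) + 2) = 2 ^ (q - 1) + 1] (mod 2 ^ q) \<and>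
        [v (2 ^ q) = 2 ^ q - 1] (mod 2 ^ q)) \<and>
     (\<forall>(q::nat) (a::nat). q \<ge> 2 \<and> 1 \<le> a \<and> a \<le> 2 ^ (q - 1) \<longrightarrow>
        [v (a + 2 ^ (q - 1)) = v a + 2 ^ (q - 1)] (mod 2 ^ q))"
proof (intro conjI)
  show "\<forall>n::nat. n \<ge> 1 \<longrightarrow> odd (v n)"
    using odd_v by blast
next
  show "\<forall>(k::nat) (l::nat). k \<ge> 1 \<longrightarrow> [v (l * k + 1) = v (l * k + 2)] (mod int k)"
    by (intro allI impI v_Suc_cong) simp_all
next
  show "\<forall>(k::nat) (l::nat). even k \<and> k \<ge> 2 \<longrightarrow>
        [v (l * k + k div 2 + 1) = v (l * k + k div 2 + 2)] (mod int k)"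
  proof (intro allI impI v_Suc_cong)
    fix k l :: nat assume k: "even k \<and> k \<ge> 2"
    then have "2 * (l * k + k div 2) = k * (2 * l + 1)"
      by (auto elim!: evenE simp: algebra_simps)
    then show "k dvd 2 * (l * k + k div 2)" by simp
  qed auto
next
  show "\<forall>(k::nat) (l::nat). odd k \<and> k \<ge> 3 \<longrightarrow> [v (l * k + (k + 3) div 2) = 0] (mod int k)"
  proof (intro allI impI v_cong_0)
    fix k l :: nat assume k: "odd k \<and> k \<ge> 3"
    then have "2 * int (l * k + (k + 3) div 2) - 3 = int k * (2 * int l + 1)"
      by (auto elim!: oddE simp: algebra_simps)
    then show "int k dvd 2 * int (l * k + (k + 3) div 2) - 3" by simp
  qed auto
next
  show "\<forall>k::nat. prime k \<longrightarrow>
        [v 1 = 1] (mod int k) \<and> [v 2 = 1] (mod int k) \<and>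
        [v (k + 1) = 1] (mod int k) \<and> [v (k + 2) = 1] (mod int k) \<and>
        (\<forall>l::nat. 2 \<le> l \<and> l \<le> k + 1 \<longrightarrow>
           [v (l * k + 1) = -1] (mod int k) \<and> [v (l * k + 2) = -1] (mod int k))"
  proof (intro allI impI)
    fix k :: nat assume k: "prime k"
    have step: "[v (l * k + 2) = v (l * k + 1)] (mod int k)" for l
      using prime_gt_0_nat[OF k] by (intro cong_sym[OF v_Suc_cong]) simp_all
    have row_1: "[v (l * k + 1) = -1] (mod int k)" if "2 \<le> l" "l \<le> k + 1" for l
      using k that by (rule v_prime_first_row_minus_1)
    show "[v 1 = 1] (mod int k) \<and> [v 2 = 1] (mod int k) \<and>
        [v (k + 1) = 1] (mod int k) \<and> [v (k + 2) = 1] (mod int k) \<and>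
        (\<forall>l::nat. 2 \<le> l \<and> l \<le> k + 1 \<longrightarrow>
           [v (l * k + 1) = -1] (mod int k) \<and> [v (l * k + 2) = -1] (mod int k))"
      using v_prime_Suc[OF k] cong_trans[OF step[of 1], of 1] row_1 cong_trans[OF step row_1]
      unfolding v_1 v_2 mult_1 by (intro conjI allI impI cong_refl) blast+
  qed
next
  show "\<forall>k::nat. prime k \<and> k > 2 \<longrightarrow>
        (\<forall>i::nat. (k + 3) div 2 \<le> i \<and> i \<le> k \<longrightarrow> [v i = 0] (mod int k))"
    using v_prime_upper[where l = 0] by simp
next
  show "\<forall>k::nat. prime k \<and> k > 2 \<longrightarrow>
        (\<forall>(l::nat) (i::nat). (k - 1) div 2 \<le> l \<and> l \<le> k \<and> (k + 3) div 2 \<le> i \<and> i \<le> k \<longrightarrow>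
           [v (l * k + i) = 0] (mod int k))"
    using v_prime_upper by blast
next
  show "\<forall>q::nat. q \<ge> 1 \<longrightarrow>
        (\<forall>(l::nat) (i::nat). 1 \<le> i \<and> i \<le> 2 ^ q \<longrightarrow>
           [v (l * 2 ^ q + i) = v i] (mod 2 ^ q)) \<and>
        (\<forall>a::int. odd a \<longrightarrow> card {i \<in> {1..2 ^ q}. [v i = a] (mod 2 ^ q)} = 2)"
    using v_two_power_period card_odd_residue by blast
next
  show "\<forall>q::nat. q \<ge> 2 \<longrightarrow>
        [v 1 = 1] (mod 2 ^ q) \<and> [v 2 = 1] (mod 2 ^ q) \<and>
        [v (2 ^ (q - 1)) = 2 ^ (q - 1) - 1] (mod 2 ^ q) \<and>
        [v (2 ^ (q - 1) + 1) = 2 ^ (q - 1) + 1] (mod 2 ^ q) \<and>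
        [v (2 ^ (q - 1) + 2) = 2 ^ (q - 1) + 1] (mod 2 ^ q) \<and>
        [v (2 ^ q) = 2 ^ q - 1] (mod 2 ^ q)"
  proof (intro allI impI)
    fix q :: nat assume q: "q \<ge> 2"
    then obtain t where t: "q = Suc t" by (cases q) auto
    have full: "[v (2 ^ q) = 2 ^ q - 1] (mod 2 ^ q)"
      by (rule cong_trans[OF v_two_power[OF q]]) (simp add: cong_iff_dvd_diff)
    have double: "2 ^ (q - 1) + 2 ^ (q - 1) = (2 :: nat) ^ q" by (simp add: t)
    \<comment> \<open>The value at \<open>2 ^ (q - 1)\<close> is recovered from the one at
      \<open>2 ^ q\<close> by cancelling the half-period increment.\<close>
    have "[v (2 ^ q) = v (2 ^ (q - 1)) + 2 ^ (q - 1)] (mod 2 ^ q)"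
      using v_add_half_period[OF q, of "2 ^ (q - 1)", unfolded double] by simp
    then have "[v (2 ^ (q - 1)) + 2 ^ (q - 1) = 2 ^ q - 1] (mod 2 ^ q)"
      using full cong_sym cong_trans by blast
    then have "[v (2 ^ (q - 1)) + 2 ^ (q - 1) = (2 ^ (q - 1) - 1) + 2 ^ (q - 1)] (mod 2 ^ q)"
      by (simp add: t)
    then have half: "[v (2 ^ (q - 1)) = 2 ^ (q - 1) - 1] (mod 2 ^ q)"
      unfolding cong_add_rcancel .
    show "[v 1 = 1] (mod 2 ^ q) \<and> [v 2 = 1] (mod 2 ^ q) \<and>
        [v (2 ^ (q - 1)) = 2 ^ (q - 1) - 1] (mod 2 ^ q) \<and>
        [v (2 ^ (q - 1) + 1) = 2 ^ (q - 1) + 1] (mod 2 ^ q) \<and>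
        [v (2 ^ (q - 1) + 2) = 2 ^ (q - 1) + 1] (mod 2 ^ q) \<and>
        [v (2 ^ q) = 2 ^ q - 1] (mod 2 ^ q)"
      using full half v_add_half_period[OF q, of 1] v_add_half_period[OF q, of 2]
      by (simp add: v_1 v_2 v_1[unfolded One_nat_def] add.commute)
  qed
next
  show "\<forall>(q::nat) (a::nat). q \<ge> 2 \<and> 1 \<le> a \<and> a \<le> 2 ^ (q - 1) \<longrightarrow>
        [v (a + 2 ^ (q - 1)) = v a + 2 ^ (q - 1)] (mod 2 ^ q)"
    using v_add_half_period by blast
qed

end
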